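(* Let $d\ge3$, let $\{S_n\}$ be the simple symmetric random walk on $\mathbb{Z}^d$, and let $\{x_n\}$ be a sequence of points in $\mathbb{Z}^d$ such that $|x_n|\sim c(\log n)^{1/(2d-4)}$ as $n\to\infty$ for some $c>0$. Then, for any $\varepsilon>0$, with probability one there exist infinitely many $n$ such that $$\xi(S_n,\infty)\ \ge\ \lambda\left(\log n+\left(\frac{d-4}{d-2}-\varepsilon\right)\log\log n\right),\qquad \xi(S_n+x_n,\infty)=0 .$$ Consequently, $n\in\mathcal{B}_n$ and $R(n,n)\le c(\log n)^{1/(2d-4)}$ infinitely often with probability one.
   Context: Simple symmetric random walk: $S_0=0$, $S_n=\sum_{k=1}^nX_k$, with $X_k$ i.i.d., $\mathbf{P}(X_1=\pm e_i)=1/(2d)$ for $i=1,\dots,d$, where $e_1,\dots,e_d$ is the system of orthogonal unit vectors of $\mathbb{Z}^d$. $|x|$ is the Euclidean norm. Local time: $\xi(x,\infty):=\sum_{k=1}^\infty I\{S_k=x\}$. $\gamma:=\mathbf{P}(S_i\ne0,\ i=1,2,\dots)>0$ and $\lambda:=-1/\log(1-\gamma)$. $k_n=(1-\delta_n)\lambda\log n$ and $\mathcal{B}_n=\{j\le n:\ \xi(S_j,\infty)\ge k_n\}$ (indices $0\le j\le n$). Here $\delta_n>0$ and $r_n>0$ are sequences such that $\delta_n$ is non-increasing, $r_n$ is non-decreasing, for any $c'>0$ one has $r_{[c'n]}/r_n<C$ with some $C>0$ ($[\cdot]$ is the integer part), $\lim_{n\to\infty}r_n^{2d-4}\frac{\log\log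 n}{\log n}=0$ and $\lim_{n\to\infty}\delta_nr_n^{2d-4}=0$. For $r\ge0$, $B(r)=\{x\in\mathbb{Z}^d:|x|\le r\}$. For $j\in\mathcal{B}_n$, $R(n,j)$ denotes the largest number such that $S_j+B(R(n,j))$ is completely covered by the random walk $S_0,S_1,S_2,\dots$, i.e. $\xi(S_j+x,\infty)>0$ for all $x\in B(R(n,j))$. *)

theory Defs
  imports "HOL-Probability.Probability" "HOL-Library.Landau_Symbols"
begin

text \<open>The lattice of dimension d is the type \<open>int ^ 'd\<close> with \<open>d = CARD('d)\<close>;
  \<open>axis i 1\<close> is the unit vector \<open>e\<^sub>i\<close>.\<close>

definition lattice_norm :: "int ^ 'd \<Rightarrow> real" where
  "lattice_norm x = norm ((\<chi> i. real_of_int (x $ i)) :: real ^ 'd)"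

definition lattice_ball :: "real \<Rightarrow> (int ^ 'd) set" where
  "lattice_ball \<rho> = {x. lattice_norm x \<le> \<rho>}"

text \<open>The steps are \<open>X\<^sub>1, X\<^sub>2, \<dots>\<close>; the value \<open>X 0\<close> is not used. The probabilities of the
  \<open>2 d\<close> unit vectors add up to 1, so they determine the law of a step.\<close>

definition simple_symmetric_steps :: "'a measure \<Rightarrow> (nat \<Rightarrow> 'a \<Rightarrow> int ^ 'd) \<Rightarrow> bool" where
  "simple_symmetric_steps M X \<longleftrightarrow>
     prob_space M \<and>
     prob_space.indep_vars M (\<lambda>_. count_space UNIV) X {1..} \<and>
     (\<forall>k\<ge>1. \<forall>i.
        measure M {\<omega> \<in> space M. X k \<omega> = axis i 1} = 1 / (2 * real CARD('d)) \<and>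
        measure M {\<omega> \<in> space M. X k \<omega> = - axis i 1} = 1 / (2 * real CARD('d)))"

definition walk :: "(nat \<Rightarrow> 'a \<Rightarrow> int ^ 'd) \<Rightarrow> nat \<Rightarrow> 'a \<Rightarrow> int ^ 'd" where
  "walk X n \<omega> = (\<Sum>k=1..n. X k \<omega>)"

text \<open>Total number of visits at the times \<open>k \<ge> 1\<close>, so the start \<open>S\<^sub>0 = 0\<close> is not counted. The
  value is extended real because the number of visits may be infinite on a null set.\<close>

definition local_time :: "(nat \<Rightarrow> 'a \<Rightarrow> int ^ 'd) \<Rightarrow> int ^ 'd \<Rightarrow> 'a \<Rightarrow> ereal" where
  "local_time X x \<omega> = (\<Sum>k. if walk X (Suc k) \<omega> = x then 1 else 0)"

definition escape_prob :: "'a measure \<Rightarrow> (nat \<Rightarrow> 'a \<Rightarrow> int ^ 'd) \<Rightarrow> real" where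
  "escape_prob M X = measure M {\<omega> \<in> space M. \<forall>i\<ge>1. walk X i \<omega> \<noteq> 0}"

definition lam :: "'a measure \<Rightarrow> (nat \<Rightarrow> 'a \<Rightarrow> int ^ 'd) \<Rightarrow> real" where
  "lam M X = - 1 / ln (1 - escape_prob M X)"

text \<open>The sequences are indexed from 1. The bound \<open>C\<close> may depend on \<open>c'\<close>.\<close>

definition admissible_rates :: "nat \<Rightarrow> (nat \<Rightarrow> real) \<Rightarrow> (nat \<Rightarrow> real) \<Rightarrow> bool" where
  "admissible_rates d \<delta> r \<longleftrightarrow>
     (\<forall>n\<ge>1. \<delta> n > 0) \<and> (\<forall>n\<ge>1. r n > 0) \<and>
     antimono_on {1..} \<delta> \<and> mono_on {1..} r \<and>
     (\<forall>c'>0. \<exists>C>0. \<forall>n\<ge>1. r (nat \<lfloor>c' * real n\<rfloor>) / r n < C) \<and>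
     ((\<lambda>n. r n ^ (2 * d - 4) * (ln (ln (real n)) / ln (real n))) \<longlonglongrightarrow> 0) \<and>
     ((\<lambda>n. \<delta> n * r n ^ (2 * d - 4)) \<longlonglongrightarrow> 0)"

definition frequent_times ::
  "'a measure \<Rightarrow> (nat \<Rightarrow> 'a \<Rightarrow> int ^ 'd) \<Rightarrow> (nat \<Rightarrow> real) \<Rightarrow> nat \<Rightarrow> 'a \<Rightarrow> nat set" where
  "frequent_times M X \<delta> n \<omega> =
     {j. j \<le> n \<and>
         local_time X (walk X j \<omega>) \<omega> \<ge> ereal ((1 - \<delta> n) * lam M X * ln (real n))}"

text \<open>The radius \<open>R(n,j)\<close>, which depends on \<open>n\<close> only through the requirement that \<open>j\<close> is a
  frequent time. It is the supremum of the real radii of completely covered balls: lattice balls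
  are constant on half-open intervals of radii, so a largest real radius does not exist, and the
  supremum is the distance from \<open>S\<^sub>j\<close> to the nearest uncovered point. It is \<open>\<infinity>\<close> if every
  point is covered.\<close>

definition covered_radius :: "(nat \<Rightarrow> 'a \<Rightarrow> int ^ 'd) \<Rightarrow> nat \<Rightarrow> 'a \<Rightarrow> ereal" where
  "covered_radius X j \<omega> =
     Sup {ereal \<rho> | \<rho>. \<rho> \<ge> 0 \<and> (\<forall>x\<in>lattice_ball \<rho>. local_time X (walk X j \<omega> + x) \<omega> > 0)}"

end

theory Submission
  imports Defs
begin

text \<open>Let \<open>q = 1 - \<gamma>\<close> be the probability of a return to the start, so that \<open>\<lambda> = - 1 / ln q\<close>. Returning \<open>k\<close>
times to the current position has probability \<open>q ^ k\<close>, which for \<open>k = \<lambda> (ln n + ln ln n)\<close> is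
\<open>1 / (n ln n)\<close>. This series diverges, so one expects that infinitely often \<open>S\<^sub>n\<close> is visited
\<open>\<lambda> (ln n + ln ln n)\<close> times, and that the demand to avoid \<open>S\<^sub>n + x\<^sub>n\<close> changes the probability only by a
constant factor: the Green function satisfies \<open>G(x) \<le> C |x| ^ (2 - d)\<close>, an excursion from the origin
that visits \<open>x\<close> has probability at most \<open>G(x) G(-x)\<close>, and for the given growth of \<open>|x\<^sub>n|\<close> this is of
order \<open>1 / ln n\<close>, the inverse of the number of excursions. The level \<open>\<lambda> (ln n + ln ln n)\<close>
exceeds both levels of the theorem, so a single statement,
\<open>heavy_point_near_unvisited_point\<close>, yields both parts.

The difficulty is the dependence between different times. The event considered for time \<open>n\<close> is
that the next \<open>k\<close> excursions from \<open>S\<^sub>n\<close> all return without meeting \<open>S\<^sub>n + x\<^sub>n\<close>, the \<open>i\<close>-th of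
them within \<open>L i = K (i + 1) ^ 4\<close> steps. The growth of \<open>L\<close> balances two effects. The sum of the
probabilities that an excursion is too long, of order \<open>L i ^ (- 1 / 2)\<close> at most, converges, so that
the restriction costs only a constant factor (\<open>loops_weight_ge\<close>). And an attempt is still undecided
after \<open>l\<close> steps with a probability whose sum over \<open>l\<close> is at most
\<open>C = (\<Sum>i. q ^ i * L i)\<close>, which is finite. Attempts that are decided before the next one starts are
independent of it, hence the covariances of the events add up to at most \<open>C\<close> times the expected
number \<open>\<mu>\<close> of successful attempts (\<open>starts_correlation\<close>). By Chebyshev's inequality a
range of times with expected number \<open>\<mu>\<close> contains no success with probability at most
\<open>(1 + 2 C) / \<mu>\<close>.

It remains to exclude visits to \<open>S\<^sub>n + x\<^sub>n\<close> before time \<open>n\<close> and after the attempt. They are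
independent of the attempt and have probability at most \<open>2 G\<close>, with \<open>G \<rightarrow> 0\<close>. Choosing first a starting
time after which \<open>G\<close> is small and then a range with \<open>\<mu>\<close> large makes both errors small. The probability of
an unspoiled success in the range is then close to \<open>1\<close>, however late the range starts
(\<open>infinitely_often_second_moment\<close>).

All events depend on finitely many steps and are described by sets of words over the unit vectors.
A word of length \<open>l\<close> has probability \<open>(2 d) ^ (- l)\<close>, and the strong Markov property is unique
factorisation of words in a prefix-free set. The bound for the Green function comes from the Fourier
integral for \<open>P(S\<^sub>l = y)\<close> together with an exponential moment bound.\<close>

section \<open>Words and transition probabilities\<close>

definition unit_steps :: "(int ^ 'd) set" where
  "unit_steps = range (\<lambda>i. axis i 1) \<union> range (\<lambda>i. - axis i 1)"

definition step_prob :: "'d::finite itself \<Rightarrow> real" where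
  "step_prob _ = 1 / (2 * real CARD('d))"

definition words :: "nat \<Rightarrow> (int ^ 'd) list set" where
  "words l = {w. set w \<subseteq> unit_steps \<and> length w = l}"

text \<open>The probability that the steps of the walk begin with a word of \<open>A\<close>, provided that no word of \<open>A\<close>
is a proper prefix of another; in general an upper bound for it.\<close>

definition weight :: "(int ^ 'd) list set \<Rightarrow> real" where
  "weight A = (\<Sum>w\<in>A. step_prob TYPE('d) ^ length w)"

text \<open>The transition probability \<open>P(S\<^sub>l = y)\<close>.\<close>

definition heat :: "nat \<Rightarrow> int ^ 'd \<Rightarrow> real" where
  "heat l y = weight {w \<in> words l. sum_list w = y}"

lemma step_prob_pos: "step_prob TYPE('d::finite) > 0"
  by (simp add: step_prob_def)

lemma finite_unit_steps [simp]: "finite (unit_steps :: (int ^ 'd) set)"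
  by (simp add: unit_steps_def)

lemma sum_unit_steps:
  "(\<Sum>e\<in>(unit_steps :: (int ^ 'd) set). f e) = (\<Sum>i\<in>UNIV. f (axis i 1) + f (- axis i 1))"
proof -
  have inj1: "inj (\<lambda>i::'d. axis i (1::int))"
    by (auto simp: inj_def axis_eq_axis)
  have inj2: "inj (\<lambda>i::'d. - axis i (1::int))"
    by (auto simp: inj_def axis_eq_axis)
  have ne: "axis i (1::int) \<noteq> - axis j 1" for i j :: 'd
  proof
    assume "axis i (1::int) = - axis j 1"
    then have "axis i (1::int) $ i = (- axis j 1) $ i" by simp
    then show False by (auto simp: axis_def split: if_splits)
  qed
  have "(\<Sum>e\<in>(unit_steps :: (int ^ 'd) set). f e)
      = sum f (range (\<lambda>i. axis i 1)) + sum f (range (\<lambda>i. - axis i 1))"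
    unfolding unit_steps_def using ne by (intro sum.union_disjoint) auto
  also have "\<dots> = (\<Sum>i\<in>UNIV. f (axis i 1)) + (\<Sum>i\<in>UNIV. f (- axis i 1))"
    by (simp add: sum.reindex[OF inj1] sum.reindex[OF inj2] o_def)
  finally show ?thesis by (simp add: sum.distrib)
qed

lemma card_unit_steps: "real (card (unit_steps :: (int ^ 'd) set)) * step_prob TYPE('d) = 1"
proof -
  have "real (card (unit_steps :: (int ^ 'd) set)) = (\<Sum>e\<in>(unit_steps :: (int ^ 'd) set). 1)"
    by simp
  also have "\<dots> = 2 * real CARD('d)" by (subst sum_unit_steps) simp
  finally show ?thesis by (simp add: step_prob_def)
qed

lemma finite_words [simp]: "finite (words l :: (int ^ 'd) list set)"
  unfolding words_def using finite_lists_length_eq[of unit_steps l] by simp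

lemma words_0: "words 0 = {[]}"
  by (auto simp: words_def)

lemma words_Suc: "words (Suc l) = (\<lambda>(e, w). e # w) ` (unit_steps \<times> words l)"
proof (intro equalityI subsetI)
  fix w :: "(int^'d) list" assume "w \<in> words (Suc l)"
  then show "w \<in> (\<lambda>(e, w). e # w) ` (unit_steps \<times> words l)"
    by (cases w) (auto simp: words_def image_iff)
qed (auto simp: words_def)

lemma sum_words_Suc:
  "(\<Sum>w\<in>words (Suc l). f w) = (\<Sum>e\<in>unit_steps. \<Sum>w\<in>words l. f (e # w))"
  unfolding words_Suc
  by (subst sum.reindex) (auto simp: inj_on_def sum.cartesian_product split_def)

lemma weight_nonneg: "weight A \<ge> 0" for A :: "(int ^ 'd) list set"
  unfolding weight_def using step_prob_pos[where 'd = 'd] by (intro sum_nonneg) (simp add: less_imp_le)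

lemma weight_mono: "finite B \<Longrightarrow> A \<subseteq> B \<Longrightarrow> weight A \<le> weight B" for A :: "(int ^ 'd) list set"
  unfolding weight_def using step_prob_pos[where 'd = 'd] by (intro sum_mono2) (auto simp: less_imp_le)

lemma weight_Un_le: "finite A \<Longrightarrow> finite B \<Longrightarrow> weight (A \<union> B) \<le> weight A + weight B"
proof -
  assume "finite A" "finite B"
  then have "weight (A \<union> B) + weight (A \<inter> B) = weight A + weight B"
    unfolding weight_def by (rule sum.union_inter)
  then show ?thesis using weight_nonneg[of "A \<inter> B"] by linarith
qed

lemma heat_nonneg: "heat l y \<ge> 0"
  unfolding heat_def by (rule weight_nonneg)

lemma heat_sum:
  fixes y :: "int ^ 'd"
  shows "heat l y = (\<Sum>w\<in>words l. if sum_list w = y then step_prob TYPE('d) ^ l else 0)"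
proof -
  have "heat l y = (\<Sum>w\<in>{w \<in> words l. sum_list w = y}. step_prob TYPE('d) ^ l)"
    unfolding heat_def weight_def by (intro sum.cong) (auto simp: words_def)
  also have "\<dots> = (\<Sum>w\<in>words l. if sum_list w = y then step_prob TYPE('d) ^ l else 0)"
    by (rule sum.inter_filter) simp
  finally show ?thesis .
qed

lemma heat_0: "heat 0 y = (if y = 0 then 1 else 0)"
  by (simp add: heat_sum words_0)

text \<open>Decomposition according to the first step.\<close>

lemma heat_Suc:
  fixes y :: "int ^ 'd"
  shows "heat (Suc l) y = step_prob TYPE('d) * (\<Sum>e\<in>unit_steps. heat l (y - e))"
proof -
  have "heat (Suc l) y = (\<Sum>e\<in>unit_steps. \<Sum>w\<in>words l.
      if e + sum_list w = y then step_prob TYPE('d) ^ Suc l else 0)"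
    by (simp add: heat_sum sum_words_Suc)
  also have "\<dots> = (\<Sum>e\<in>unit_steps. step_prob TYPE('d) * heat l (y - e))"
    unfolding heat_sum sum_distrib_left
    by (intro sum.cong refl) (auto simp: algebra_simps)
  finally show ?thesis by (simp add: sum_distrib_left)
qed

section \<open>The Fourier integral\<close>

text \<open>Lebesgue measure on one period. It is left unnormalised, so powers of \<open>2 * pi\<close> appear in the
inversion formula.\<close>

definition angle :: "real measure" where
  "angle = restrict_space lborel {-pi..pi}"

lemma angle_finite: "finite_measure angle"
  by (rule finite_measureI) (simp add: angle_def emeasure_restrict_space space_restrict_space)

lemma space_angle [simp]: "space angle = {-pi..pi}"
  by (simp add: angle_def space_restrict_space)

lemma borel_measurable_angle: "f \<in> borel_measurable borel \<Longrightarrow> f \<in> borel_measurable angle"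
  unfolding angle_def by (rule measurable_restrict_space1) simp

lemma integral_angle:
  fixes f :: "real \<Rightarrow> 'b :: {banach, second_countable_topology}"
  shows "integral\<^sup>L angle f = (\<integral>x. indicator {-pi..pi} x *\<^sub>R f x \<partial>lborel)"
  unfolding angle_def by (rule integral_restrict_space) simp

lemma integral_cis_angle:
  "integral\<^sup>L angle (\<lambda>t. cis (real_of_int m * t)) = (if m = 0 then 2 * pi else 0)"
proof (cases "m = 0")
  case True
  have "measure angle {-pi..pi} = 2 * pi"
    by (simp add: angle_def measure_restrict_space)
  then show ?thesis using True by (simp add: scaleR_conv_of_real)
next
  case False
  let ?F = "\<lambda>t. cis (real_of_int m * t) / (\<i> * of_int m)"
  have "integral\<^sup>L angle (\<lambda>t. cis (real_of_int m * t)) = ?F pi - ?F (-pi)"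
    unfolding integral_angle
  proof (rule integral_FTC_atLeastAtMost)
    fix t :: real
    have "((\<lambda>t. exp (\<i> * of_int m * complex_of_real t) / (\<i> * of_int m)) has_vector_derivative
        exp (\<i> * of_int m * complex_of_real t)) (at t within {-pi..pi})"
      by (rule has_vector_derivative_real_field)
        (use False in \<open>auto intro!: derivative_eq_intros simp: field_simps\<close>)
    then show "(?F has_vector_derivative cis (real_of_int m * t)) (at t within {-pi..pi})"
      by (simp add: cis_conv_exp mult.assoc)
  qed (auto intro!: continuous_intros)
  also have "cis (real_of_int m * pi) = cis (real_of_int m * - pi)"
    by (simp add: complex_eq_iff sin_integer_2pi mult.commute sin_npi_int)
  finally show ?thesis using False by simp
qed

abbreviation angles :: "'d itself \<Rightarrow> ('d::finite \<Rightarrow> real) measure" where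
  "angles _ \<equiv> Pi\<^sub>M UNIV (\<lambda>_::'d. angle)"

interpretation ang: product_sigma_finite "\<lambda>_::'d::finite. angle"
  using angle_finite unfolding product_sigma_finite_def finite_measure_def by auto

lemma angles_finite: "finite_measure (angles TYPE('d::finite))"
proof
  have "emeasure (angles TYPE('d)) (\<Pi>\<^sub>E i\<in>UNIV. space angle) = (\<Prod>i\<in>(UNIV::'d set). emeasure angle (space angle))"
    by (rule ang.emeasure_PiM) (auto simp del: space_angle)
  also have "\<dots> \<noteq> \<infinity>"
    using finite_measure.emeasure_finite[OF angle_finite] by (simp add: power_eq_top_ennreal del: space_angle)
  finally show "emeasure (angles TYPE('d)) (space (angles TYPE('d))) \<noteq> \<infinity>"
    by (simp add: space_PiM)
qed

lemma angle_component [measurable]: "(\<lambda>\<theta>::'d::finite \<Rightarrow> real. \<theta> i) \<in> borel_measurable (angles TYPE('d))"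
proof -
  have "(\<lambda>\<theta>. \<theta> i) \<in> angles TYPE('d) \<rightarrow>\<^sub>M angle"
    by (rule measurable_component_singleton) simp
  moreover have "(\<lambda>x. x) \<in> angle \<rightarrow>\<^sub>M borel"
    by (rule borel_measurable_angle) simp
  ultimately show ?thesis using measurable_compose by blast
qed

text \<open>The integrand of the inversion formula. The mean of the cosines is the characteristic function of
one step.\<close>

definition fourier :: "nat \<Rightarrow> int ^ 'd \<Rightarrow> ('d \<Rightarrow> real) \<Rightarrow> complex" where
  "fourier l y \<theta> = of_real (((\<Sum>i\<in>UNIV. cos (\<theta> i)) / real CARD('d)) ^ l)
     * (\<Prod>i\<in>UNIV. cis (real_of_int (y $ i) * \<theta> i))"

lemma norm_mean_cos_le: "\<bar>(\<Sum>i\<in>UNIV. cos (\<theta> i)) / real CARD('d)\<bar> \<le> (1::real)" for \<theta> :: "'d::finite \<Rightarrow> real"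
proof -
  have "\<bar>\<Sum>i\<in>(UNIV::'d set). cos (\<theta> i)\<bar> \<le> (\<Sum>i\<in>(UNIV::'d set). \<bar>cos (\<theta> i)\<bar>)"
    by (rule sum_abs)
  also have "\<dots> \<le> (\<Sum>i\<in>(UNIV::'d set). 1)" by (intro sum_mono) auto
  finally show ?thesis by (simp add: field_simps)
qed

lemma norm_fourier: "norm (fourier l y \<theta>) = \<bar>(\<Sum>i\<in>UNIV. cos (\<theta> i)) / real CARD('d)\<bar> ^ l" for y :: "int ^ 'd"
  unfolding fourier_def norm_mult norm_of_real power_abs
  by (simp flip: prod_norm)

lemma fourier_measurable [measurable]: "fourier l y \<in> borel_measurable (angles TYPE('d))" for y :: "int ^ 'd"
proof -
  have [measurable]: "(\<lambda>\<theta>. cis (real_of_int (y $ i) * \<theta> i)) \<in> borel_measurable (angles TYPE('d))" for i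
    unfolding cis_conv_exp by measurable
  show ?thesis unfolding fourier_def by measurable
qed

lemma fourier_integrable: "integrable (angles TYPE('d)) (fourier l y)" for y :: "int ^ 'd"
proof (rule finite_measure.integrable_const_bound[OF angles_finite, where B = 1])
  show "AE \<theta> in angles TYPE('d). norm (fourier l y \<theta>) \<le> 1"
    unfolding norm_fourier using norm_mean_cos_le[where 'd = 'd] by (auto intro!: power_le_one)
qed measurable

text \<open>The two steps along a coordinate axis multiply the character by \<open>cis (- \<theta> i)\<close> and
\<open>cis (\<theta> i)\<close>, which add up to \<open>2 * cos (\<theta> i)\<close>. So the integrand obeys the same recursion as
\<open>heat_Suc\<close>.\<close>

lemma fourier_Suc:
  fixes y :: "int ^ 'd"
  shows "fourier (Suc l) y \<theta> = of_real (step_prob TYPE('d)) * (\<Sum>e\<in>unit_steps. fourier l (y - e) \<theta>)"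
proof -
  have shift: "(\<Prod>j\<in>UNIV. cis (real_of_int ((y - s *s axis i 1) $ j) * \<theta> j))
      = (\<Prod>j\<in>UNIV. cis (real_of_int (y $ j) * \<theta> j)) * cis (- real_of_int s * \<theta> i)" for i s
  proof -
    have "(\<Prod>j\<in>UNIV. cis (real_of_int ((y - s *s axis i 1) $ j) * \<theta> j))
      = (\<Prod>j\<in>UNIV. cis (real_of_int (y $ j) * \<theta> j) * (if j = i then cis (- real_of_int s * \<theta> i) else 1))"
      by (intro prod.cong) (auto simp: axis_def cis_mult algebra_simps)
    then show ?thesis by (simp add: prod.distrib)
  qed
  have two: "cis (- \<theta> i) + cis (\<theta> i) = of_real (2 * cos (\<theta> i))" for i
    by (simp add: complex_eq_iff)
  let ?P = "(\<Prod>j\<in>UNIV. cis (real_of_int (y $ j) * \<theta> j))"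
  let ?f = "(\<Sum>i\<in>(UNIV::'d set). cos (\<theta> i)) / real CARD('d)"
  have "(\<Sum>e\<in>unit_steps. fourier l (y - e) \<theta>)
      = (\<Sum>i\<in>UNIV. of_real (?f ^ l) * ?P * (cis (- \<theta> i) + cis (\<theta> i)))"
    unfolding sum_unit_steps
  proof (intro sum.cong refl)
    fix i :: 'd
    show "fourier l (y - axis i 1) \<theta> + fourier l (y - - axis i 1) \<theta>
      = of_real (?f ^ l) * ?P * (cis (- \<theta> i) + cis (\<theta> i))"
      using shift[of 1 i] shift[of "-1" i] by (simp add: fourier_def algebra_simps)
  qed
  also have "\<dots> = of_real (?f ^ l) * ?P * of_real (2 * (\<Sum>i\<in>(UNIV::'d set). cos (\<theta> i)))"
    unfolding two by (simp add: sum_distrib_left)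
  also have "of_real (step_prob TYPE('d)) * \<dots> = fourier (Suc l) y \<theta>"
    by (simp add: fourier_def step_prob_def field_simps)
  finally show ?thesis by simp
qed

text \<open>Both sides satisfy the same recursion in \<open>l\<close>; for \<open>l = 0\<close> the claim is the orthogonality of the
characters.\<close>

lemma heat_fourier:
  fixes y :: "int ^ 'd"
  shows "of_real (heat l y * (2 * pi) ^ CARD('d)) = integral\<^sup>L (angles TYPE('d)) (fourier l y)"
proof (induction l arbitrary: y)
  case 0
  have "integral\<^sup>L (angles TYPE('d)) (fourier 0 y)
      = (\<Prod>i\<in>UNIV. integral\<^sup>L angle (\<lambda>t. cis (real_of_int (y $ i) * t)))"
    unfolding fourier_def
  proof (simp, rule ang.product_integral_prod)
    fix i
    show "integrable angle (\<lambda>t. cis (real_of_int (y $ i) * t))"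
      by (rule finite_measure.integrable_const_bound[OF angle_finite, where B = 1])
        (auto intro!: borel_measurable_angle borel_measurable_continuous_onI continuous_intros)
  qed simp
  also have "\<dots> = (if y = 0 then (2 * pi) ^ CARD('d) else 0)"
    unfolding integral_cis_angle by (auto simp: vec_eq_iff)
  finally show ?case by (simp add: heat_0)
next
  case (Suc l)
  have "integral\<^sup>L (angles TYPE('d)) (fourier (Suc l) y)
      = of_real (step_prob TYPE('d)) * (\<Sum>e\<in>unit_steps. integral\<^sup>L (angles TYPE('d)) (fourier l (y - e)))"
    unfolding fourier_Suc[abs_def] by (simp add: fourier_integrable)
  also have "\<dots> = of_real (heat (Suc l) y * (2 * pi) ^ CARD('d))"
    unfolding Suc[symmetric] heat_Suc by (simp add: sum_distrib_right mult.assoc)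
  finally show ?case by simp
qed

lemma sin_ge_half: "0 \<le> t \<Longrightarrow> t \<le> pi / 2 \<Longrightarrow> t / 2 \<le> sin (t::real)"
proof -
  assume t: "0 \<le> t" "t \<le> pi / 2"
  have poly: "(\<Sum>m<3. sin_coeff m * t ^ m) = t"
    by (simp add: numeral_3_eq_3 sin_coeff_def)
  have rem: "inverse (fact 3) * \<bar>t\<bar> ^ 3 = t ^ 3 / 6"
    using t by (simp add: fact_numeral)
  have "\<bar>sin t - t\<bar> \<le> t ^ 3 / 6"
    using Maclaurin_sin_bound[of t 3] unfolding poly rem .
  then have 1: "sin t \<ge> t - t ^ 3 / 6" by linarith
  have "t ^ 3 = t * (t * t)" by (simp add: power3_eq_cube)
  have "t < 1.6" using t pi_less_4 pi_approx by simp
  then have "t * t \<le> 1.6 * 1.6" using t by (intro mult_mono) auto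
  then have "t * (t * t) \<le> t * 3" using t by (intro mult_left_mono) auto
  then show ?thesis using 1 by (simp add: power3_eq_cube)
qed

text \<open>Near each zero of the sine the left side is dominated by a Cauchy density, whose primitive
is elementary. Every point of the period is within \<open>pi / 2\<close> of one of the three zeros.\<close>

lemma exp_sin_le:
  fixes t b :: real
  assumes t: "t \<in> {-pi..pi}" and b: "b \<ge> 0"
  shows "exp (- b * (sin t)\<^sup>2) \<le> (\<Sum>c\<in>{-pi, 0, pi}. 1 / (1 + (b / 4) * (t - c)\<^sup>2))"
proof -
  have key: "exp (- b * (sin t)\<^sup>2) \<le> 1 / (1 + (b / 4) * s\<^sup>2)" if s: "\<bar>s\<bar> \<le> pi / 2" "\<bar>sin t\<bar> = \<bar>sin s\<bar>" for s
  proof -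
    have "\<bar>s\<bar> / 2 \<le> \<bar>sin s\<bar>"
      using sin_ge_half[of "\<bar>s\<bar>"] s by (cases "s \<ge> 0") auto
    then have "(\<bar>s\<bar> / 2)\<^sup>2 \<le> \<bar>sin s\<bar>\<^sup>2" by (intro power_mono) auto
    then have "b * (s\<^sup>2 / 4) \<le> b * (sin t)\<^sup>2"
      using s b by (intro mult_left_mono) (auto simp: power_divide simp flip: power2_abs[of "sin t"])
    then have "1 + (b / 4) * s\<^sup>2 \<le> 1 + b * (sin t)\<^sup>2" by simp
    also have "\<dots> \<le> exp (b * (sin t)\<^sup>2)" by (rule exp_ge_add_one_self)
    finally have le: "1 + (b / 4) * s\<^sup>2 \<le> exp (b * (sin t)\<^sup>2)" .
    have "0 < 1 + (b / 4) * s\<^sup>2" using b by (intro add_pos_nonneg) auto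
    then show ?thesis using le by (simp add: exp_minus field_simps)
  qed
  have nn: "1 / (1 + (b / 4) * s\<^sup>2) \<ge> 0" for s using b by simp
  have sum: "(\<Sum>c\<in>{-pi, 0, pi}. 1 / (1 + (b / 4) * (t - c)\<^sup>2)) =
     1 / (1 + (b / 4) * (t + pi)\<^sup>2) + (1 / (1 + (b / 4) * t\<^sup>2) + 1 / (1 + (b / 4) * (t - pi)\<^sup>2))"
    by (subst sum.insert, auto)+
  consider "t < - pi / 2" | "\<bar>t\<bar> \<le> pi / 2" | "t > pi / 2" by linarith
  then show ?thesis
  proof cases
    case 1
    then have "exp (- b * (sin t)\<^sup>2) \<le> 1 / (1 + (b / 4) * (t + pi)\<^sup>2)"
      using t by (intro key) auto
    then show ?thesis using nn[of t] nn[of "t - pi"] unfolding sum by linarith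
  next
    case 2
    then have "exp (- b * (sin t)\<^sup>2) \<le> 1 / (1 + (b / 4) * (t)\<^sup>2)"
      using t by (intro key) auto
    then show ?thesis using nn[of "t + pi"] nn[of "t - pi"] unfolding sum by linarith
  next
    case 3
    then have "exp (- b * (sin t)\<^sup>2) \<le> 1 / (1 + (b / 4) * (t - pi)\<^sup>2)"
      using t by (intro key) auto
    then show ?thesis using nn[of "t + pi"] nn[of t] unfolding sum by linarith
  qed
qed

lemma integral_cauchy_angle:
  fixes b c :: real
  assumes b: "b > 0"
  shows "integral\<^sup>L angle (\<lambda>t. 1 / (1 + b * (t - c)\<^sup>2)) \<le> pi / sqrt b"
proof -
  let ?F = "\<lambda>t. arctan (sqrt b * (t - c)) / sqrt b"
  have pos: "1 + b * (t - c)\<^sup>2 > 0" for t using b by (intro add_pos_nonneg) auto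
  have "integral\<^sup>L angle (\<lambda>t. 1 / (1 + b * (t - c)\<^sup>2)) = ?F pi - ?F (- pi)"
    unfolding integral_angle
  proof (rule integral_FTC_atLeastAtMost)
    fix t :: real
    have "(?F has_field_derivative 1 / (1 + b * (t - c)\<^sup>2)) (at t within {-pi..pi})"
    proof -
      have "(?F has_field_derivative inverse (1 + (sqrt b * (t - c))\<^sup>2) * (sqrt b * 1) / sqrt b) (at t within {-pi..pi})"
        by (intro DERIV_cdivide DERIV_chain2[OF DERIV_arctan] DERIV_cmult) (auto intro!: derivative_eq_intros)
      moreover have "inverse (1 + (sqrt b * (t - c))\<^sup>2) * (sqrt b * 1) / sqrt b = 1 / (1 + b * (t - c)\<^sup>2)"
        using b by (simp add: power_mult_distrib divide_inverse)
      ultimately show ?thesis by simp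
    qed
    then show "(?F has_vector_derivative 1 / (1 + b * (t - c)\<^sup>2)) (at t within {-pi..pi})"
      by (rule has_real_derivative_iff_has_vector_derivative[THEN iffD1])
  qed (use pos in \<open>auto intro!: continuous_intros simp: less_imp_neq[symmetric]\<close>)
  also have "\<dots> \<le> pi / sqrt b"
    using arctan_bounded[of "sqrt b * (pi - c)"] arctan_bounded[of "sqrt b * (- pi - c)"] b
    by (simp add: divide_right_mono flip: diff_divide_distrib)
  finally show ?thesis .
qed

lemma integral_exp_sin:
  fixes b :: real
  assumes b: "b > 0"
  shows "integral\<^sup>L angle (\<lambda>t. exp (- b * (sin t)\<^sup>2)) \<le> 6 * pi / sqrt b"
proof -
  have int: "integrable angle (\<lambda>t. 1 / (1 + (b / 4) * (t - c)\<^sup>2))" for c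
  proof (rule finite_measure.integrable_const_bound[OF angle_finite, where B = 1])
    show "AE t in angle. norm (1 / (1 + (b / 4) * (t - c)\<^sup>2)) \<le> 1"
    proof (rule AE_I2)
      fix t
      have "1 \<le> 1 + (b / 4) * (t - c)\<^sup>2" using b by simp
      then show "norm (1 / (1 + (b / 4) * (t - c)\<^sup>2)) \<le> 1"
        by (simp only: real_norm_def abs_divide abs_one) (simp add: divide_le_eq)
    qed
  qed (auto intro!: borel_measurable_angle)
  have int': "integrable angle (\<lambda>t. exp (- b * (sin t)\<^sup>2))"
    using b by (intro finite_measure.integrable_const_bound[OF angle_finite, where B = 1])
      (auto intro!: borel_measurable_angle borel_measurable_continuous_onI continuous_intros)
  have "integral\<^sup>L angle (\<lambda>t. exp (- b * (sin t)\<^sup>2))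
      \<le> integral\<^sup>L angle (\<lambda>t. \<Sum>c\<in>{-pi, 0, pi}. 1 / (1 + (b / 4) * (t - c)\<^sup>2))"
    using b int int' by (intro integral_mono Bochner_Integration.integrable_sum exp_sin_le) auto
  also have "\<dots> = (\<Sum>c\<in>{-pi, 0, pi}. integral\<^sup>L angle (\<lambda>t. 1 / (1 + (b / 4) * (t - c)\<^sup>2)))"
    by (rule Bochner_Integration.integral_sum) (rule int)
  also have "\<dots> \<le> (\<Sum>c\<in>{-pi, 0, pi}. pi / sqrt (b / 4))"
    using b by (intro sum_mono integral_cauchy_angle) simp
  also have "\<dots> = 6 * pi / sqrt b"
    by (subst sum.insert, simp, simp)+ (simp add: real_sqrt_divide)
  finally show ?thesis .
qed

lemma abs_cos_le: "\<bar>cos t\<bar> \<le> 1 - (sin t)\<^sup>2 / (2::real)"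
proof -
  have "0 \<le> (1 - \<bar>cos t\<bar>)\<^sup>2" by simp
  then have "2 * \<bar>cos t\<bar> \<le> 1 + (cos t)\<^sup>2" by (simp add: power2_eq_square algebra_simps)
  then show ?thesis using sin_cos_squared_add[of t] by linarith
qed

text \<open>The modulus of the mean of cosines is at most \<open>1\<close> minus an average, and \<open>1 - s \<le> exp (- s)\<close> turns that
average into a product over the coordinates. The multidimensional integral then factorises. Bounding
\<open>\<bar>cos\<bar>\<close> by the sine also covers the second maximum at \<open>(pi, \<dots>, pi)\<close>, which reflects the
parity of the walk.\<close>

lemma norm_fourier_le:
  fixes y :: "int ^ 'd"
  shows "norm (fourier l y \<theta>) \<le> (\<Prod>i\<in>UNIV. exp (- (real l / (2 * real CARD('d))) * (sin (\<theta> i))\<^sup>2))"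
proof -
  let ?d = "real CARD('d)"
  have "\<bar>\<Sum>i\<in>(UNIV::'d set). cos (\<theta> i)\<bar> \<le> (\<Sum>i\<in>(UNIV::'d set). \<bar>cos (\<theta> i)\<bar>)"
    by (rule sum_abs)
  also have "\<dots> \<le> (\<Sum>i\<in>(UNIV::'d set). 1 - (sin (\<theta> i))\<^sup>2 / 2)"
    by (intro sum_mono abs_cos_le)
  also have "\<dots> = ?d * (1 - (\<Sum>i\<in>UNIV. (sin (\<theta> i))\<^sup>2) / (2 * ?d))"
    by (simp add: sum_subtractf right_diff_distrib flip: sum_divide_distrib)
  finally have "\<bar>(\<Sum>i\<in>(UNIV::'d set). cos (\<theta> i)) / ?d\<bar> \<le> 1 - (\<Sum>i\<in>UNIV. (sin (\<theta> i))\<^sup>2) / (2 * ?d)"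
    by (simp add: pos_divide_le_eq mult.commute)
  also have "\<dots> \<le> exp (- ((\<Sum>i\<in>UNIV. (sin (\<theta> i))\<^sup>2) / (2 * ?d)))"
    using exp_ge_add_one_self[of "- ((\<Sum>i\<in>UNIV. (sin (\<theta> i))\<^sup>2) / (2 * ?d))"] by simp
  finally have "norm (fourier l y \<theta>) \<le> exp (- ((\<Sum>i\<in>UNIV. (sin (\<theta> i))\<^sup>2) / (2 * ?d))) ^ l"
    unfolding norm_fourier by (intro power_mono) auto
  also have "\<dots> = exp (\<Sum>i\<in>UNIV. - (real l / (2 * ?d)) * (sin (\<theta> i))\<^sup>2)"
    by (simp add: exp_of_nat_mult[symmetric] sum_distrib_left sum_divide_distrib sum_negf field_simps)
  finally show ?thesis by (simp add: exp_sum)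
qed

text \<open>The on-diagonal bound \<open>O(l ^ (- d / 2))\<close>: each coordinate contributes a factor \<open>O(l ^ (- 1 / 2))\<close>.\<close>

lemma heat_le_diag:
  fixes y :: "int ^ 'd"
  assumes l: "l > 0"
  shows "heat l y \<le> (3 * sqrt (2 * real CARD('d)) / sqrt (real l)) ^ CARD('d)"
proof -
  let ?d = "real CARD('d)"
  let ?b = "real l / (2 * ?d)"
  have b: "?b > 0" using l by simp
  have int: "integrable angle (\<lambda>t. exp (- ?b * (sin t)\<^sup>2))"
    using b by (intro finite_measure.integrable_const_bound[OF angle_finite, where B = 1])
      (auto intro!: borel_measurable_angle borel_measurable_continuous_onI continuous_intros)
  have "heat l y * (2 * pi) ^ CARD('d) = norm (integral\<^sup>L (angles TYPE('d)) (fourier l y))"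
    unfolding heat_fourier[symmetric] using heat_nonneg[of l y] by (simp add: norm_mult norm_power)
  also have "\<dots> \<le> integral\<^sup>L (angles TYPE('d)) (\<lambda>\<theta>. norm (fourier l y \<theta>))"
    by (rule integral_norm_bound)
  also have "\<dots> \<le> integral\<^sup>L (angles TYPE('d)) (\<lambda>\<theta>. \<Prod>i\<in>UNIV. exp (- ?b * (sin (\<theta> i))\<^sup>2))"
    by (intro integral_mono norm_fourier_le integrable_norm fourier_integrable ang.product_integrable_prod int) simp
  also have "\<dots> = (\<Prod>i\<in>(UNIV::'d set). integral\<^sup>L angle (\<lambda>t. exp (- ?b * (sin t)\<^sup>2)))"
    by (intro ang.product_integral_prod int) simp
  also have "\<dots> \<le> (\<Prod>i\<in>(UNIV::'d set). 6 * pi / sqrt ?b)"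
    by (intro prod_mono conjI integral_exp_sin b Bochner_Integration.integral_nonneg) auto
  also have "\<dots> = (3 * sqrt (2 * ?d) / sqrt (real l)) ^ CARD('d) * (2 * pi) ^ CARD('d)"
  proof -
    have "6 * pi / sqrt ?b = (3 * sqrt (2 * ?d) / sqrt (real l)) * (2 * pi)"
      using l by (simp add: real_sqrt_divide)
    then show ?thesis by (simp only: prod_constant power_mult_distrib)
  qed
  finally show ?thesis by simp
qed

section \<open>Gaussian bounds and the Green function\<close>

lemma exp_plus_exp_minus_le: "exp s + exp (- s) \<le> 2 * exp (s\<^sup>2)" for s :: real
proof -
  have *: "exp s + exp (- s) \<le> 2 * exp (s\<^sup>2)" if s: "s \<ge> 0" for s :: real
  proof (cases "s \<le> 1")
    case True
    have "1 + s + s\<^sup>2 / 2 \<le> exp s" by (rule exp_lower_Taylor_quadratic[OF s])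
    then have "(1 + s + s\<^sup>2 / 2) * (1 - s + s\<^sup>2) \<le> exp s * (1 - s + s\<^sup>2)"
      using s True by (intro mult_right_mono) auto
    moreover have "(1 + s + s\<^sup>2 / 2) * (1 - s + s\<^sup>2) = 1 + s\<^sup>2 / 2 + s ^ 3 / 2 + s ^ 4 / 2"
      by (simp add: field_simps power2_eq_square power3_eq_cube power4_eq_xxxx)
    moreover have "s\<^sup>2 / 2 + s ^ 3 / 2 + s ^ 4 / 2 \<ge> 0" using s by simp
    ultimately have "1 \<le> exp s * (1 - s + s\<^sup>2)" by linarith
    then have "exp (- s) \<le> 1 - s + s\<^sup>2"
      by (simp add: exp_minus inverse_eq_divide divide_le_eq mult.commute)
    moreover have "exp s \<le> 1 + s + s\<^sup>2" using exp_bound[OF s True] .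
    moreover have "1 + s\<^sup>2 \<le> exp (s\<^sup>2)" by (rule exp_ge_add_one_self)
    ultimately show ?thesis by linarith
  next
    case False
    then have "s * 1 \<le> s * s" by (intro mult_left_mono) auto
    then have "exp s \<le> exp (s\<^sup>2)" by (simp add: power2_eq_square)
    moreover have "exp (- s) \<le> exp s" using s by simp
    ultimately show ?thesis by linarith
  qed
  show ?thesis using *[of s] *[of "- s"] by (cases "s \<ge> 0") auto
qed

text \<open>The weights of words are multiplicative, so the moment is the \<open>l\<close>-th power of that of a single
step.\<close>

lemma exp_moment_le:
  fixes i :: "'d::finite"
  shows "(\<Sum>w\<in>(words l :: (int ^ 'd) list set). step_prob TYPE('d) ^ l * exp (s * real_of_int (sum_list w $ i))) \<le> exp (s\<^sup>2 * real l)"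
proof (induction l)
  case 0
  then show ?case by (simp add: words_0)
next
  case (Suc l)
  let ?p = "step_prob TYPE('d)"
  have p: "?p > 0" by (rule step_prob_pos)
  have one: "(\<Sum>e\<in>(unit_steps :: (int ^ 'd) set). ?p * exp (s * real_of_int (e $ i))) \<le> exp (s\<^sup>2)"
  proof -
    have "(\<Sum>e\<in>(unit_steps :: (int ^ 'd) set). ?p * exp (s * real_of_int (e $ i)))
        = (\<Sum>j\<in>UNIV. ?p * (exp (s * real_of_int (axis j 1 $ i)) + exp (- (s * real_of_int (axis j 1 $ i)))))"
      by (simp add: sum_unit_steps algebra_simps)
    also have "\<dots> \<le> (\<Sum>j\<in>(UNIV :: 'd set). ?p * (2 * exp (s\<^sup>2)))"
    proof (intro sum_mono mult_left_mono)
      fix j :: 'd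
      show "exp (s * real_of_int (axis j 1 $ i)) + exp (- (s * real_of_int (axis j 1 $ i))) \<le> 2 * exp (s\<^sup>2)"
        using exp_plus_exp_minus_le[of s] by (auto simp: axis_def)
    qed (use p in simp)
    also have "\<dots> = exp (s\<^sup>2)" by (simp add: step_prob_def)
    finally show ?thesis .
  qed
  have "(\<Sum>w\<in>(words (Suc l) :: (int ^ 'd) list set). ?p ^ Suc l * exp (s * real_of_int (sum_list w $ i)))
      = (\<Sum>e\<in>(unit_steps :: (int ^ 'd) set). ?p * exp (s * real_of_int (e $ i)))
        * (\<Sum>w\<in>(words l :: (int ^ 'd) list set). ?p ^ l * exp (s * real_of_int (sum_list w $ i)))"
    unfolding sum_words_Suc sum_product
    by (intro sum.cong refl) (simp add: algebra_simps exp_add)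
  also have "\<dots> \<le> exp (s\<^sup>2) * exp (s\<^sup>2 * real l)"
    using p by (intro mult_mono one Suc sum_nonneg) auto
  also have "\<dots> = exp (s\<^sup>2 * real (Suc l))" by (simp add: algebra_simps flip: exp_add)
  finally show ?case .
qed

text \<open>Markov's inequality for the exponential moment with the optimal parameter \<open>r / (2 * l)\<close>.\<close>

lemma coordinate_tail_le:
  fixes i :: "'d::finite" and \<sigma> :: int
  assumes l: "l > 0" and \<sigma>: "\<bar>\<sigma>\<bar> = 1" and r: "r \<ge> 0"
  shows "weight {w \<in> (words l :: (int ^ 'd) list set). r \<le> real_of_int (\<sigma> * sum_list w $ i)} \<le> exp (- r\<^sup>2 / (4 * real l))"
proof -
  let ?p = "step_prob TYPE('d)"
  let ?s = "r / (2 * real l)"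
  have p: "?p > 0" by (rule step_prob_pos)
  have s: "?s \<ge> 0" using r by simp
  have "weight {w \<in> (words l :: (int ^ 'd) list set). r \<le> real_of_int (\<sigma> * sum_list w $ i)}
    \<le> (\<Sum>w\<in>{w \<in> (words l :: (int ^ 'd) list set). r \<le> real_of_int (\<sigma> * sum_list w $ i)}.
        ?p ^ l * exp ((?s * \<sigma>) * real_of_int (sum_list w $ i)) * exp (- ?s * r))"
    unfolding weight_def
  proof (intro sum_mono)
    fix w :: "(int ^ 'd) list" assume w: "w \<in> {w \<in> words l. r \<le> real_of_int (\<sigma> * sum_list w $ i)}"
    then have "0 \<le> ?s * (real_of_int (\<sigma> * sum_list w $ i) - r)" using s by (intro mult_nonneg_nonneg) auto
  then have "1 \<le> exp (?s * (real_of_int (\<sigma> * sum_list w $ i) - r))" by (simp only: one_le_exp_iff)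
    then have "?p ^ l * 1 \<le> ?p ^ l * exp (?s * (real_of_int (\<sigma> * sum_list w $ i) - r))"
      using p by (intro mult_left_mono) auto
    also have "\<dots> = ?p ^ l * exp ((?s * \<sigma>) * real_of_int (sum_list w $ i)) * exp (- ?s * r)"
      by (simp only: mult.assoc exp_add[symmetric]) (simp add: algebra_simps diff_divide_distrib)
    finally show "?p ^ length w \<le> ?p ^ l * exp ((?s * \<sigma>) * real_of_int (sum_list w $ i)) * exp (- ?s * r)"
      using w by (simp add: words_def)
  qed
  also have "\<dots> \<le> (\<Sum>w\<in>(words l :: (int ^ 'd) list set).
        ?p ^ l * exp ((?s * \<sigma>) * real_of_int (sum_list w $ i)) * exp (- ?s * r))"
    using p by (intro sum_mono2) auto
  also have "\<dots> \<le> exp ((?s * \<sigma>)\<^sup>2 * real l) * exp (- ?s * r)"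
    unfolding sum_distrib_right[symmetric] by (intro mult_right_mono exp_moment_le) auto
  also have "(?s * real_of_int \<sigma>)\<^sup>2 = ?s\<^sup>2"
    using \<sigma> by (auto simp: abs_if split: if_splits)
  also have "exp (?s\<^sup>2 * real l) * exp (- ?s * r) = exp (- r\<^sup>2 / (4 * real l))"
    using l by (simp only: exp_add[symmetric]) (simp add: field_simps power2_eq_square)
  finally show ?thesis .
qed

lemma sum_words_add:
  "(\<Sum>w\<in>words (l1 + l2). f w) = (\<Sum>v\<in>words l1. \<Sum>w\<in>words l2. f (v @ w))"
proof -
  have eq: "words (l1 + l2) = (\<lambda>(v, w). v @ w) ` (words l1 \<times> words l2)"
  proof (intro equalityI subsetI)
    fix w :: "(int^'d) list" assume w: "w \<in> words (l1 + l2)"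
    have "w = (\<lambda>(v, w). v @ w) (take l1 w, drop l1 w)" by simp
    moreover have "(take l1 w, drop l1 w) \<in> words l1 \<times> words l2"
      using w by (auto simp: words_def dest: in_set_takeD in_set_dropD)
    ultimately show "w \<in> (\<lambda>(v, w). v @ w) ` (words l1 \<times> words l2)" by (rule image_eqI)
  qed (auto simp: words_def)
  show ?thesis unfolding eq
    by (subst sum.reindex) (auto simp: inj_on_def sum.cartesian_product split_def words_def)
qed

definition diag_bound :: "'d::finite itself \<Rightarrow> nat \<Rightarrow> real" where
  "diag_bound _ l = (3 * sqrt (2 * real CARD('d)) / sqrt (real l)) ^ CARD('d)"

lemma heat_le_diag_bound: "l > 0 \<Longrightarrow> heat l y \<le> diag_bound TYPE('d) l" for y :: "int ^ 'd"
  unfolding diag_bound_def by (rule heat_le_diag)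

lemma diag_bound_nonneg: "diag_bound TYPE('d::finite) l \<ge> 0"
  by (simp add: diag_bound_def)

text \<open>If a path reaches \<open>x\<close>, one of its two parts covers half of the distance in direction \<open>i\<close>. The tail
bound applies to that part and the on-diagonal bound to the other one.\<close>

lemma heat_offdiag:
  fixes x :: "int ^ 'd" and \<sigma> :: int
  assumes l: "l1 > 0" "l2 > 0" and \<sigma>: "\<bar>\<sigma>\<bar> = 1" and r: "real_of_int (\<sigma> * x $ i) = r" "r \<ge> 0"
  shows "heat (l1 + l2) x \<le> diag_bound TYPE('d) l2 * exp (- (r / 2)\<^sup>2 / (4 * real l1))
      + diag_bound TYPE('d) l1 * exp (- (r / 2)\<^sup>2 / (4 * real l2))"
proof -
  let ?p = "step_prob TYPE('d)"
  have p: "?p > 0" by (rule step_prob_pos)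
  let ?T = "\<lambda>l. {w \<in> (words l :: (int ^ 'd) list set). r / 2 \<le> real_of_int (\<sigma> * sum_list w $ i)}"
  define far :: "int ^ 'd \<Rightarrow> bool" where "far y \<longleftrightarrow> r / 2 \<le> real_of_int (\<sigma> * y $ i)" for y
  let ?if = "\<lambda>b. if b then 1 else (0::real)"
  have split: "?if (v + w = x) \<le> ?if (far v) * ?if (w = x - v) + ?if (far w) * ?if (v = x - w)" for v w
  proof -
    have "far v \<or> far w" if "v + w = x"
    proof -
      have "real_of_int (\<sigma> * v $ i) + real_of_int (\<sigma> * w $ i) = r"
        unfolding r(1)[symmetric] that[symmetric] by (simp add: algebra_simps)
      then show ?thesis unfolding far_def by linarith
    qed
    then show ?thesis by (auto simp: algebra_simps)
  qed
  have tail: "(\<Sum>v\<in>words l. ?p ^ l * ?if (far (sum_list v))) \<le> exp (- (r / 2)\<^sup>2 / (4 * real l))" if "l > 0" for l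
  proof -
    have "(\<Sum>v\<in>words l. ?p ^ l * ?if (far (sum_list v))) = weight (?T l)"
      unfolding weight_def far_def sum.inter_filter[OF finite_words] by (intro sum.cong) (auto simp: words_def)
    also have "\<dots> \<le> exp (- (r / 2)\<^sup>2 / (4 * real l))" using that \<sigma> r by (intro coordinate_tail_le) auto
    finally show ?thesis .
  qed
  have heat_if: "heat l y = (\<Sum>w\<in>words l. ?p ^ l * ?if (sum_list w = y))" for l and y :: "int ^ 'd"
    unfolding heat_sum by (intro sum.cong) auto
  have prod: "(\<Sum>v\<in>words l. \<Sum>w\<in>words l'. ?p ^ l * ?p ^ l' * (?if (far (sum_list v)) * ?if (sum_list w = x - sum_list v)))
      \<le> diag_bound TYPE('d) l' * exp (- (r / 2)\<^sup>2 / (4 * real l))" if "l > 0" "l' > 0" for l l'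
  proof -
    have "(\<Sum>v\<in>words l. \<Sum>w\<in>words l'. ?p ^ l * ?p ^ l' * (?if (far (sum_list v)) * ?if (sum_list w = x - sum_list v)))
        = (\<Sum>v\<in>words l. ?p ^ l * ?if (far (sum_list v)) * heat l' (x - sum_list v))"
      unfolding heat_if sum_distrib_left by (intro sum.cong refl) simp
    also have "\<dots> \<le> (\<Sum>v\<in>words l. ?p ^ l * ?if (far (sum_list v)) * diag_bound TYPE('d) l')"
      using p that by (intro sum_mono mult_left_mono heat_le_diag_bound) auto
    also have "\<dots> \<le> exp (- (r / 2)\<^sup>2 / (4 * real l)) * diag_bound TYPE('d) l'"
      unfolding sum_distrib_right[symmetric] by (intro mult_right_mono tail that diag_bound_nonneg)
    finally show ?thesis by (simp add: mult.commute)
  qed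
  have "heat (l1 + l2) x = (\<Sum>v\<in>words l1. \<Sum>w\<in>words l2. ?p ^ l1 * ?p ^ l2 * ?if (sum_list v + sum_list w = x))"
    unfolding heat_if sum_words_add by (simp add: power_add)
  also have "\<dots> \<le> (\<Sum>v\<in>words l1. \<Sum>w\<in>words l2. ?p ^ l1 * ?p ^ l2 *
      (?if (far (sum_list v)) * ?if (sum_list w = x - sum_list v) + ?if (far (sum_list w)) * ?if (sum_list v = x - sum_list w)))"
    using p by (intro sum_mono mult_left_mono split) auto
  also have "\<dots> = (\<Sum>v\<in>words l1. \<Sum>w\<in>words l2. ?p ^ l1 * ?p ^ l2 * (?if (far (sum_list v)) * ?if (sum_list w = x - sum_list v)))
      + (\<Sum>w\<in>words l2. \<Sum>v\<in>words l1. ?p ^ l2 * ?p ^ l1 * (?if (far (sum_list w)) * ?if (sum_list v = x - sum_list w)))"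
    by (subst (2) sum.swap) (simp only: distrib_left sum.distrib mult.commute[of "?p ^ l2"])
  also have "\<dots> \<le> diag_bound TYPE('d) l2 * exp (- (r / 2)\<^sup>2 / (4 * real l1))
      + diag_bound TYPE('d) l1 * exp (- (r / 2)\<^sup>2 / (4 * real l2))"
    by (intro add_mono prod l)
  finally show ?thesis .
qed

lemma power_over_fact_le_exp: "v ^ n / fact n \<le> exp v" if "v \<ge> 0" for v :: real
proof -
  have "(\<Sum>k\<in>{n}. v ^ k / fact k) \<le> (\<Sum>k. v ^ k / fact k)"
    using that summable_exp_generic[of v] by (intro sum_le_suminf) (auto simp: scaleR_conv_of_real field_simps)
  then show ?thesis by (simp add: exp_def scaleR_conv_of_real divide_inverse mult.commute)
qed

text \<open>The factor \<open>2\<close> counts the two parts of a split path; \<open>sqrt 3\<close> accounts for the length of the shorter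
part, which is at least \<open>l / 3\<close>.\<close>

definition heat_const :: "'d::finite itself \<Rightarrow> real" where
  "heat_const _ = 2 * (3 * sqrt (2 * real CARD('d)) * sqrt 3) ^ CARD('d)"

lemma heat_const_ge: "heat_const TYPE('d::finite) \<ge> 2"
proof -
  have "1 \<le> real CARD('d)" using zero_less_card_finite[where 'a = 'd] by linarith
  then have "sqrt 1 \<le> sqrt (2 * real CARD('d))" by (intro real_sqrt_le_mono) linarith
  moreover have "sqrt 1 \<le> sqrt (3::real)" by (intro real_sqrt_le_mono) simp
  moreover have "1 \<le> 3 * sqrt (2 * real CARD('d))" using calculation unfolding real_sqrt_one by linarith
  ultimately have "1 * 1 \<le> (3 * sqrt (2 * real CARD('d))) * sqrt 3" by (intro mult_mono) auto
  then have "1 \<le> (3 * sqrt (2 * real CARD('d)) * sqrt 3) ^ CARD('d)" by (intro one_le_power) simp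
  then show ?thesis by (simp add: heat_const_def)
qed

lemma heat_le:
  fixes y :: "int ^ 'd"
  assumes "l > 0"
  shows "heat l y \<le> heat_const TYPE('d) / sqrt (real l) ^ CARD('d)"
proof -
  let ?K = "3 * sqrt (2 * real CARD('d))"
  have "heat l y \<le> ?K ^ CARD('d) / sqrt (real l) ^ CARD('d)"
    using heat_le_diag[OF assms, of y] by (simp add: power_divide)
  also have "\<dots> \<le> heat_const TYPE('d) / sqrt (real l) ^ CARD('d)"
  proof (rule divide_right_mono)
    have "?K ^ CARD('d) * 1 \<le> ?K ^ CARD('d) * (2 * sqrt 3 ^ CARD('d))"
    proof (intro mult_left_mono)
      have "sqrt 1 \<le> sqrt (3::real)" by (intro real_sqrt_le_mono) simp
      then have "1 \<le> sqrt (3::real) ^ CARD('d)" by (intro one_le_power) simp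
      then show "1 \<le> 2 * sqrt (3::real) ^ CARD('d)" by linarith
    qed simp
    then show "?K ^ CARD('d) \<le> heat_const TYPE('d)"
      by (simp add: heat_const_def power_mult_distrib mult_ac)
  qed simp
  finally show ?thesis .
qed

lemma heat_gauss:
  fixes x :: "int ^ 'd"
  assumes l: "l > 0" and r: "r = \<bar>real_of_int (x $ i)\<bar>"
  shows "heat l x \<le> heat_const TYPE('d) / sqrt (real l) ^ CARD('d) * exp (- r\<^sup>2 / (16 * real l))"
proof -
  let ?K = "3 * sqrt (2 * real CARD('d))"
  obtain \<sigma> :: int where \<sigma>: "\<bar>\<sigma>\<bar> = 1" "real_of_int (\<sigma> * x $ i) = r"
  proof (cases "x $ i \<ge> 0")
    case True
    then show ?thesis using that[of 1] r by simp
  next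
    case False
    then show ?thesis using that[of "- 1"] r by simp
  qed
  \<comment> \<open>A single step cannot be split into two nonempty parts and is treated directly.\<close>
  consider "l = 1" | "l \<ge> 2" using l by linarith
  then show ?thesis
  proof cases
    case 1
    have "heat l x \<le> 2 * exp (- r\<^sup>2 / (16 * real l))"
    proof (cases "r \<le> 1")
      case True
      have "r\<^sup>2 \<le> 1" using True r power_le_one[of r 2] by simp
      then have "1 / 2 \<le> 1 + (- r\<^sup>2 / (16 * real l))" using 1 by simp
      also have "\<dots> \<le> exp (- r\<^sup>2 / (16 * real l))" by (rule exp_ge_add_one_self)
      finally have "1 \<le> 2 * exp (- r\<^sup>2 / (16 * real l))" by simp
      moreover have "heat l x \<le> 1"
      proof -
        have "heat l x \<le> (\<Sum>w\<in>(words l :: (int ^ 'd) list set). step_prob TYPE('d) ^ l)"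
          unfolding heat_sum using step_prob_pos[where 'd = 'd] by (intro sum_mono) auto
        also have "\<dots> = 1"
          unfolding 1 One_nat_def sum_words_Suc words_0
          using card_unit_steps[where 'd = 'd] by simp
        finally show ?thesis .
      qed
      ultimately show ?thesis by linarith
    next
      case False
      have "x \<notin> unit_steps" using False r by (auto simp: unit_steps_def axis_def split: if_splits)
      then have "heat l x = 0" using 1 by (auto simp: heat_Suc heat_0)
      then show ?thesis by simp
    qed
    also have "\<dots> \<le> heat_const TYPE('d) * exp (- r\<^sup>2 / (16 * real l))"
      using heat_const_ge[where 'd = 'd] by (intro mult_right_mono) auto
    finally show ?thesis using 1 by simp
  next
    case 2
    define l1 where "l1 = l div 2"
    define l2 where "l2 = l - l1"
    have b: "l1 > 0" "l2 > 0" "l1 + l2 = l" "l \<le> 3 * l1" "l \<le> 3 * l2"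
      using 2 unfolding l1_def l2_def by linarith+
    have one: "diag_bound TYPE('d) m * exp (- (r / 2)\<^sup>2 / (4 * real k))
        \<le> (?K * sqrt 3) ^ CARD('d) / sqrt (real l) ^ CARD('d) * exp (- r\<^sup>2 / (16 * real l))"
      if m: "m > 0" "l \<le> 3 * m" and k: "k > 0" "k \<le> l" for m k
    proof (intro mult_mono)
      have "sqrt (real l) \<le> sqrt (3 * real m)" using m by (intro real_sqrt_le_mono) linarith
      then have "sqrt (real l) \<le> sqrt 3 * sqrt (real m)" by (simp add: real_sqrt_mult)
      then have "?K * sqrt (real l) \<le> ?K * (sqrt 3 * sqrt (real m))" by (intro mult_left_mono) auto
      then have "?K / sqrt (real m) \<le> (?K * sqrt 3) / sqrt (real l)"
        using m l by (simp add: divide_le_eq le_divide_eq mult_ac)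
      then have "(?K / sqrt (real m)) ^ CARD('d) \<le> ((?K * sqrt 3) / sqrt (real l)) ^ CARD('d)"
        by (intro power_mono) auto
      then show "diag_bound TYPE('d) m \<le> (?K * sqrt 3) ^ CARD('d) / sqrt (real l) ^ CARD('d)"
        unfolding diag_bound_def by (simp only: power_divide)
      have "r\<^sup>2 / (16 * real l) \<le> r\<^sup>2 / (16 * real k)"
        using k by (intro divide_left_mono) auto
      then show "exp (- (r / 2)\<^sup>2 / (4 * real k)) \<le> exp (- r\<^sup>2 / (16 * real l))"
        by (simp add: power_divide)
    qed auto
    have "heat l x \<le> diag_bound TYPE('d) l2 * exp (- (r / 2)\<^sup>2 / (4 * real l1))
      + diag_bound TYPE('d) l1 * exp (- (r / 2)\<^sup>2 / (4 * real l2))"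
      using heat_offdiag[OF b(1,2) \<sigma>] r unfolding b(3) by simp
    also have "\<dots> \<le> (?K * sqrt 3) ^ CARD('d) / sqrt (real l) ^ CARD('d) * exp (- r\<^sup>2 / (16 * real l))
       + (?K * sqrt 3) ^ CARD('d) / sqrt (real l) ^ CARD('d) * exp (- r\<^sup>2 / (16 * real l))"
      using b by (intro add_mono one) auto
    finally show ?thesis by (simp add: heat_const_def mult_ac)
  qed
qed

text \<open>Telescoping with \<open>1 / l ^ (3 / 2) \<le> 2 / sqrt (l - 1) - 2 / sqrt l\<close>.\<close>

lemma sum_inverse_three_halves_le:
  assumes "R \<ge> (1::nat)"
  shows "(\<Sum>l\<in>{R<..N}. 1 / sqrt (real l) ^ 3) \<le> 2 / sqrt (real R)"
proof (cases "R \<le> N")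
  case True
  have "(\<Sum>l\<in>{R<..N}. 1 / sqrt (real l) ^ 3) \<le> 2 / sqrt (real R) - 2 / sqrt (real N)"
    using True
  proof (induction N rule: dec_induct)
    case (step N)
    let ?a = "sqrt (real N)" and ?b = "sqrt (real (Suc N))"
    have ab: "0 < ?a" "?a \<le> ?b" using step assms by auto
    have "(?b - ?a) * (?b + ?a) = 1" by (simp add: algebra_simps)
    moreover have "?b + ?a > 0" by (rule add_pos_pos[OF order_less_le_trans[OF ab] ab(1)])
    ultimately have "?b - ?a = 1 / (?b + ?a)" by (metis nonzero_eq_divide_eq less_irrefl)
    moreover have "1 / ?a - 1 / ?b = (?b - ?a) / (?a * ?b)" using ab by (simp add: diff_frac_eq)
    ultimately have "1 / ?a - 1 / ?b = 1 / (?a * ?b * (?b + ?a))" by simp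
    also have "\<dots> \<ge> 1 / (?b * ?b * (?b + ?b))"
      using ab by (intro divide_left_mono mult_mono mult_pos_pos add_pos_pos) auto
    finally have "1 / (?b * ?b * (?b + ?b)) \<le> 1 / ?a - 1 / ?b" .
    moreover have "1 / (?b * ?b * (?b + ?b)) = (1 / ?b ^ 3) / 2" by (simp add: power3_eq_cube)
    ultimately have "(1 / ?b ^ 3) / 2 \<le> 1 / ?a - 1 / ?b" by (simp only:)
    moreover have "u \<le> 2 * v - 2 * w" if "u / 2 \<le> v - w" for u v w :: real using that by simp
    ultimately have "1 / ?b ^ 3 \<le> 2 * (1 / ?a) - 2 * (1 / ?b)" by blast
    then have "1 / ?b ^ 3 \<le> 2 / ?a - 2 / ?b" by (simp only: times_divide_eq_right mult_1_right)
    moreover have "{R<..Suc N} = insert (Suc N) {R<..N}" using step by auto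
    ultimately show ?case using step.IH by simp
  qed simp
  also have "\<dots> \<le> 2 / sqrt (real R)" by simp
  finally show ?thesis .
qed (use assms in simp)

lemma return_tail:
  assumes d: "CARD('d::finite) \<ge> 3" and L: "L \<ge> 1"
  shows "(\<Sum>l\<in>{L<..N}. heat l (y :: int ^ 'd)) \<le> 2 * heat_const TYPE('d) / sqrt (real L)"
proof -
  have "(\<Sum>l\<in>{L<..N}. heat l y) \<le> (\<Sum>l\<in>{L<..N}. heat_const TYPE('d) * (1 / sqrt (real l) ^ 3))"
  proof (rule sum_mono)
    fix l assume l: "l \<in> {L<..N}"
    have "heat l y \<le> heat_const TYPE('d) / sqrt (real l) ^ CARD('d)" using l by (intro heat_le) auto
    also have "\<dots> \<le> heat_const TYPE('d) / sqrt (real l) ^ 3"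
      using l d heat_const_ge[where 'd = 'd] by (intro divide_left_mono power_increasing) auto
    finally show "heat l y \<le> heat_const TYPE('d) * (1 / sqrt (real l) ^ 3)" by simp
  qed
  also have "\<dots> \<le> heat_const TYPE('d) * (2 / sqrt (real L))"
    unfolding sum_distrib_left[symmetric]
    using heat_const_ge[where 'd = 'd] by (intro mult_left_mono sum_inverse_three_halves_le L) auto
  finally show ?thesis by (simp add: mult.commute)
qed

definition green_const :: "'d::finite itself \<Rightarrow> real" where
  "green_const _ = heat_const TYPE('d) * (fact CARD('d) * 16 ^ CARD('d) + 2)"

text \<open>The sum is split at time \<open>r\<^sup>2\<close>. Before it the Gaussian factor, replaced by the power
\<open>(l / r\<^sup>2) ^ d\<close> up to a constant, makes each of the \<open>r\<^sup>2\<close> terms at most of order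
\<open>r ^ (- d)\<close>; afterwards the on-diagonal bound is summable.\<close>

lemma green_coordinate_le:
  fixes x :: "int ^ 'd"
  assumes d: "CARD('d) \<ge> 3" and r: "r = \<bar>real_of_int (x $ i)\<bar>" "x $ i \<noteq> 0"
  shows "(\<Sum>l\<in>{0<..N}. heat l x) \<le> green_const TYPE('d) / r ^ (CARD('d) - 2)"
proof -
  let ?d = "CARD('d)" and ?A = "heat_const TYPE('d)"
  define \<rho> where "\<rho> = nat \<bar>x $ i\<bar>"
  have r\<rho>: "r = real \<rho>" and \<rho>: "\<rho> \<ge> 1" using r by (auto simp: \<rho>_def)
  have A: "?A > 0" using heat_const_ge[where 'd = 'd] by linarith
  obtain m where m: "?d = m + 3" using d by (metis add.commute le_Suc_ex)
  let ?R = "\<rho>\<^sup>2"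
  have near: "heat l x \<le> ?A * (fact ?d * 16 ^ ?d) / r ^ ?d" if l: "l > 0" "l \<le> ?R" for l
  proof -
    let ?s = "sqrt (real l)"
    have s: "?s > 0" "?s \<le> r"
      using l \<rho> by (auto simp: r\<rho> intro!: real_le_lsqrt simp flip: of_nat_power)
    have ssq: "real l = ?s * ?s" by simp
    let ?v = "r\<^sup>2 / (16 * real l)"
    have v: "?v > 0" using l \<rho> by (simp add: r\<rho>)
    have "?v ^ ?d / fact ?d \<le> exp ?v" using v by (intro power_over_fact_le_exp) auto
    then have "exp (- ?v) \<le> fact ?d / ?v ^ ?d"
    proof -
      have "?v ^ ?d > 0" using v by (rule zero_less_power)
      then have "inverse (exp ?v) \<le> inverse (?v ^ ?d / fact ?d)"
        using \<open>?v ^ ?d / fact ?d \<le> exp ?v\<close> by (intro le_imp_inverse_le) (auto simp del: power_divide)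
      then show ?thesis by (simp only: exp_minus inverse_divide)
    qed
    also have "\<dots> = fact ?d * 16 ^ ?d * (?s ^ ?d * ?s ^ ?d) / (r ^ ?d * r ^ ?d)"
    proof -
      have "?v = (r * r) / (16 * (?s * ?s))" by (simp add: power2_eq_square)
      then show ?thesis
        by (simp only: power_divide power_mult_distrib divide_divide_eq_right mult.assoc)
    qed
    finally have e: "exp (- ?v) \<le> fact ?d * 16 ^ ?d * (?s ^ ?d * ?s ^ ?d) / (r ^ ?d * r ^ ?d)" .
    have "heat l x \<le> ?A / ?s ^ ?d * exp (- ?v)"
      using heat_gauss[OF l(1) r(1)] by simp
    also have "\<dots> \<le> ?A / ?s ^ ?d * (fact ?d * 16 ^ ?d * (?s ^ ?d * ?s ^ ?d) / (r ^ ?d * r ^ ?d))"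
      using A s by (intro mult_left_mono e) auto
    also have "\<dots> = ?A * (fact ?d * 16 ^ ?d) / r ^ ?d * (?s ^ ?d / r ^ ?d)"
      using s by (simp add: field_simps)
    also have "\<dots> \<le> ?A * (fact ?d * 16 ^ ?d) / r ^ ?d * 1"
    proof (rule mult_left_mono)
      have "?s ^ ?d \<le> r ^ ?d" using s by (intro power_mono) auto
      moreover have "r ^ ?d > 0" using order_less_le_trans[OF s] by (rule zero_less_power)
      ultimately show "?s ^ ?d / r ^ ?d \<le> 1" by (simp only: divide_le_eq_1_pos)
      show "0 \<le> ?A * (fact ?d * 16 ^ ?d) / r ^ ?d"
        using A \<open>r ^ ?d > 0\<close> by (intro divide_nonneg_pos mult_nonneg_nonneg) auto
    qed
    finally show ?thesis by simp
  qed
  have far: "heat l x \<le> ?A / r ^ m * (1 / sqrt (real l) ^ 3)" if l: "l > ?R" for l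
  proof -
    let ?s = "sqrt (real l)"
    have s: "0 < r" "r \<le> ?s"
      using l \<rho> by (auto simp: r\<rho> intro!: real_le_rsqrt simp flip: of_nat_power)
    have "heat l x \<le> ?A / ?s ^ ?d" using l by (intro heat_le) auto
    also have "\<dots> = ?A / (?s ^ m * ?s ^ 3)" by (simp only: m power_add)
    also have "\<dots> \<le> ?A / (r ^ m * ?s ^ 3)"
      using A s order_less_le_trans[OF s]
      by (intro divide_left_mono mult_right_mono power_mono mult_pos_pos zero_less_power) auto
    finally show ?thesis by simp
  qed
  have "(\<Sum>l\<in>{0<..N}. heat l x) \<le> (\<Sum>l\<in>{0<..?R} \<union> {?R<..N}. heat l x)"
    by (intro sum_mono2 heat_nonneg) auto
  also have "\<dots> = (\<Sum>l\<in>{0<..?R}. heat l x) + (\<Sum>l\<in>{?R<..N}. heat l x)"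
    by (intro sum.union_disjoint) auto
  also have "\<dots> \<le> (\<Sum>l\<in>{0<..?R}. ?A * (fact ?d * 16 ^ ?d) / r ^ ?d)
      + (\<Sum>l\<in>{?R<..N}. ?A / r ^ m * (1 / sqrt (real l) ^ 3))"
    by (intro add_mono sum_mono near far) auto
  also have "(\<Sum>l\<in>{0<..?R}. ?A * (fact ?d * 16 ^ ?d) / r ^ ?d) = ?A * (fact ?d * 16 ^ ?d) / r ^ (m + 1)"
    using \<rho> by (simp add: r\<rho> m power_add power2_eq_square power3_eq_cube)
  also have "(\<Sum>l\<in>{?R<..N}. ?A / r ^ m * (1 / sqrt (real l) ^ 3)) \<le> ?A / r ^ m * (2 / sqrt (real ?R))"
    unfolding sum_distrib_left[symmetric]
    using A \<rho> by (intro mult_left_mono sum_inverse_three_halves_le) (auto simp: r\<rho>)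
  also have "?A / r ^ m * (2 / sqrt (real ?R)) = 2 * ?A / r ^ (m + 1)"
    by (simp add: r\<rho> mult.commute)
  also have "?A * (fact ?d * 16 ^ ?d) / r ^ (m + 1) + 2 * ?A / r ^ (m + 1) = green_const TYPE('d) / r ^ (?d - 2)"
    by (simp add: green_const_def m add_divide_distrib algebra_simps)
  finally show ?thesis by simp
qed

lemma ex_large_coordinate:
  fixes x :: "int ^ 'd"
  shows "\<exists>i. lattice_norm x \<le> real CARD('d) * \<bar>real_of_int (x $ i)\<bar>"
proof (rule ccontr)
  assume "\<not> ?thesis"
  then have less: "\<bar>real_of_int (x $ i)\<bar> < lattice_norm x / real CARD('d)" for i
    by (auto simp: not_le field_simps)
  have "lattice_norm x \<le> (\<Sum>i\<in>(UNIV :: 'd set). \<bar>real_of_int (x $ i)\<bar>)"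
    unfolding lattice_norm_def using norm_le_l1_cart[of "(\<chi> i. real_of_int (x $ i)) :: real ^ 'd"] by simp
  also have "\<dots> < (\<Sum>i\<in>(UNIV :: 'd set). lattice_norm x / real CARD('d))"
    by (intro sum_strict_mono less) auto
  finally show False by simp
qed

lemma lattice_norm_minus: "lattice_norm (- x) = lattice_norm x"
proof -
  have "((\<chi> i. real_of_int ((- x) $ i)) :: real ^ 'a) = - (\<chi> i. real_of_int (x $ i))"
    by (simp add: vec_eq_iff)
  then show ?thesis unfolding lattice_norm_def by (simp only: norm_minus_cancel)
qed

lemma green_le:
  fixes x :: "int ^ 'd"
  assumes d: "CARD('d) \<ge> 3" and x: "\<rho> \<le> lattice_norm x" "\<rho> > 0"
  shows "(\<Sum>l\<in>{0<..N}. heat l x) \<le> green_const TYPE('d) * real CARD('d) ^ (CARD('d) - 2) / \<rho> ^ (CARD('d) - 2)"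
proof -
  let ?d = "real CARD('d)"
  obtain i where i: "lattice_norm x \<le> ?d * \<bar>real_of_int (x $ i)\<bar>"
    using ex_large_coordinate by blast
  have le: "\<rho> / ?d \<le> \<bar>real_of_int (x $ i)\<bar>" using i x by (simp add: pos_divide_le_eq mult.commute)
  have pos: "\<rho> / ?d > 0" using x by simp
  have nz: "x $ i \<noteq> 0" using le pos by auto
  have g: "green_const TYPE('d) \<ge> 0" using heat_const_ge[where 'd = 'd] by (simp add: green_const_def)
  have "(\<Sum>l\<in>{0<..N}. heat l x) \<le> green_const TYPE('d) / \<bar>real_of_int (x $ i)\<bar> ^ (CARD('d) - 2)"
    by (rule green_coordinate_le[OF d refl nz])
  also have "\<dots> \<le> green_const TYPE('d) / (\<rho> / ?d) ^ (CARD('d) - 2)"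
    using le pos g by (intro divide_left_mono power_mono mult_pos_pos zero_less_power) auto
  finally show ?thesis by (simp add: power_divide)
qed

section \<open>Excursions and loops as words\<close>

definition excursions :: "nat \<Rightarrow> (int ^ 'd) set \<Rightarrow> (int ^ 'd) list set" where
  "excursions L V = {w. set w \<subseteq> unit_steps \<and> w \<noteq> [] \<and> length w \<le> L \<and> sum_list w = 0
     \<and> (\<forall>j\<in>{0<..<length w}. sum_list (take j w) \<noteq> 0)
     \<and> (\<forall>j\<le>length w. sum_list (take j w) \<notin> V)}"

text \<open>The combinatorial form of a stopping rule: at most one word of the set is read along a
trajectory, so what follows it is determined.\<close>

definition prefix_free :: "'b list set \<Rightarrow> bool" where
  "prefix_free A \<longleftrightarrow> (\<forall>v\<in>A. \<forall>v'\<in>A. \<forall>w w'. v @ w = v' @ w' \<longrightarrow> v = v')"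

text \<open>Concatenations of \<open>k\<close> excursions, with the bound \<open>L i\<close> on the length of excursion number \<open>i\<close>
(counted from \<open>0\<close>). These are the successful attempts.\<close>

fun loops :: "(nat \<Rightarrow> nat) \<Rightarrow> (int ^ 'd) set \<Rightarrow> nat \<Rightarrow> (int ^ 'd) list set" where
  "loops L V 0 = {[]}"
| "loops L V (Suc k) = (\<lambda>(v, w). v @ w) ` (loops L V k \<times> excursions (L k) V)"

lemma finite_excursions [simp]: "finite (excursions L V :: (int ^ 'd) list set)"
proof (rule finite_subset)
  show "excursions L V \<subseteq> {w :: (int ^ 'd) list. set w \<subseteq> unit_steps \<and> length w \<le> L}"
    by (auto simp: excursions_def)
qed (simp add: finite_lists_length_le)

lemma finite_loops [simp]: "finite (loops L V k)"
  by (induction k) auto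

lemma excursions_prefix_free: "prefix_free (excursions L V)" for V :: "(int ^ 'd) set"
proof -
  have *: False if v: "v \<in> excursions L V" and v': "v' \<in> excursions L V"
    and eq: "v @ w = v' @ w'" and len: "length v < length v'" for v v' w w' :: "(int ^ 'd) list"
  proof -
    have "take (length v) (v @ w) = take (length v) (v' @ w')" using eq by simp
    then have "take (length v) v' = v" using len by simp
    moreover have "length v \<in> {0<..<length v'}" using v len by (auto simp: excursions_def)
    then have "sum_list (take (length v) v') \<noteq> 0" using v' by (auto simp: excursions_def)
    ultimately show False using v by (simp add: excursions_def)
  qed
  show ?thesis unfolding prefix_free_def
  proof (intro ballI allI impI)
    fix v v' w w' assume v: "v \<in> excursions L V" "v' \<in> excursions L V" and eq: "v @ w = v' @ w'"
    have "length v = length v'"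
      using *[OF v eq] *[OF v(2,1) eq[symmetric]] by (meson linorder_neqE_nat)
    then show "v = v'" using eq by simp
  qed
qed

lemma inj_on_append: "prefix_free A \<Longrightarrow> inj_on (\<lambda>(v, w). v @ w) (A \<times> B)"
  unfolding inj_on_def prefix_free_def by (clarsimp split: prod.splits) (metis same_append_eq)

lemma prefix_free_append:
  assumes A: "prefix_free A" and B: "prefix_free B"
  shows "prefix_free ((\<lambda>(v, w). v @ w) ` (A \<times> B))"
  unfolding prefix_free_def
proof (intro ballI allI impI)
  fix x x' u u' assume x: "x \<in> (\<lambda>(v, w). v @ w) ` (A \<times> B)" "x' \<in> (\<lambda>(v, w). v @ w) ` (A \<times> B)"
    and eq: "x @ u = x' @ u'"
  from x obtain v w v' w' where vw: "x = v @ w" "x' = v' @ w'" "v \<in> A" "v' \<in> A" "w \<in> B" "w' \<in> B"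
    by auto
  have "v @ (w @ u) = v' @ (w' @ u')" using eq vw by simp
  then have v: "v = v'" using A vw unfolding prefix_free_def by blast
  then have "w @ u = w' @ u'" using eq vw by simp
  then have "w = w'" using B vw unfolding prefix_free_def by blast
  then show "x = x'" using v vw by simp
qed

lemma loops_prefix_free: "prefix_free (loops L V k)"
proof (induction k)
  case 0
  then show ?case by (simp add: prefix_free_def)
next
  case (Suc k)
  then show ?case by (simp only: loops.simps prefix_free_append excursions_prefix_free)
qed

lemma weight_append_le:
  fixes A B :: "(int ^ 'd) list set"
  assumes "finite A" "finite B"
  shows "weight ((\<lambda>(v, w). v @ w) ` (A \<times> B)) \<le> weight A * weight B"
proof -
  let ?p = "step_prob TYPE('d)"
  have "weight ((\<lambda>(v, w). v @ w) ` (A \<times> B)) \<le> (\<Sum>z\<in>A \<times> B. ?p ^ length ((\<lambda>(v, w). v @ w) z))"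
    unfolding weight_def using assms step_prob_pos[where 'd = 'd]
    by (intro sum_image_le[unfolded o_def]) auto
  also have "\<dots> = weight A * weight B"
    unfolding weight_def sum_product sum.cartesian_product by (intro sum.cong) (auto simp: power_add)
  finally show ?thesis .
qed

lemma weight_append:
  fixes A B :: "(int ^ 'd) list set"
  assumes "prefix_free A"
  shows "weight ((\<lambda>(v, w). v @ w) ` (A \<times> B)) = weight A * weight B"
  unfolding weight_def sum.reindex[OF inj_on_append[OF assms]] sum_product sum.cartesian_product
  by (intro sum.cong) (auto simp: power_add)

text \<open>The strong Markov property at the successive return times: factorisation in a prefix-free set is
unique, so weights multiply.\<close>

lemma weight_loops: "weight (loops L V k) = (\<Prod>i<k. weight (excursions (L i) V))"
proof (induction k)
  case 0
  then show ?case by (simp add: weight_def)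
next
  case (Suc k)
  then show ?case by (simp add: weight_append[OF loops_prefix_free])
qed

lemma excursions_anti_avoid: "excursions L V \<subseteq> excursions L {}"
  by (auto simp: excursions_def)

lemma excursions_mono: "L \<le> L' \<Longrightarrow> excursions L V \<subseteq> excursions L' V"
  by (auto simp: excursions_def)

lemma loops_anti_avoid: "loops L V k \<subseteq> loops L {} k"
proof (induction k)
  case (Suc k)
  then show ?case using excursions_anti_avoid[of "L k" V] by (auto intro!: image_mono)
qed simp

lemma loops_steps: "w \<in> loops L V k \<Longrightarrow> set w \<subseteq> unit_steps"
proof (induction k arbitrary: w)
  case (Suc k)
  then obtain v u where "w = v @ u" "v \<in> loops L V k" "u \<in> excursions (L k) V" by auto
  then show ?case using Suc.IH[of v] by (simp add: excursions_def)
qed simp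

lemma loops_sum: "w \<in> loops L V k \<Longrightarrow> sum_list w = 0"
  by (induction k arbitrary: w) (auto simp: excursions_def)

lemma loops_avoid:
  assumes "0 \<notin> V" "w \<in> loops L V k" "j \<le> length w"
  shows "sum_list (take j w) \<notin> V"
  using assms(2,3)
proof (induction k arbitrary: w j)
  case 0
  then show ?case using assms(1) by simp
next
  case (Suc k)
  then obtain v u where w: "w = v @ u" "v \<in> loops L V k" "u \<in> excursions (L k) V" by auto
  show ?case
  proof (cases "j \<le> length v")
    case True
    then show ?thesis using Suc.IH[OF w(2) True] w by simp
  next
    case False
    then have "sum_list (take j w) = sum_list (take (j - length v) u)"
      using w loops_sum[OF w(2)] by simp
    moreover have "j - length v \<le> length u" using Suc.prems w by simp
    ultimately show ?thesis using w(3) by (simp add: excursions_def)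
  qed
qed

definition zeros :: "(int ^ 'd) list \<Rightarrow> nat set" where
  "zeros w = {j \<in> {1..length w}. sum_list (take j w) = 0}"

lemma finite_zeros [simp]: "finite (zeros w)"
  by (simp add: zeros_def)

lemma zeros_append:
  assumes "sum_list v = 0"
  shows "card (zeros (v @ w)) = card (zeros v) + card (zeros w)"
proof -
  have "zeros (v @ w) = zeros v \<union> (\<lambda>j. j + length v) ` zeros w"
  proof (intro equalityI subsetI)
    fix j assume j: "j \<in> zeros (v @ w)"
    show "j \<in> zeros v \<union> (\<lambda>j. j + length v) ` zeros w"
    proof (cases "j \<le> length v")
      case True
      then show ?thesis using j by (simp add: zeros_def)
    next
      case False
      then have "j = (j - length v) + length v" "j - length v \<in> zeros w"
        using j assms by (auto simp: zeros_def)
      then show ?thesis by blast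
    qed
  qed (use assms in \<open>auto simp: zeros_def\<close>)
  moreover have "zeros v \<inter> (\<lambda>j. j + length v) ` zeros w = {}" by (auto simp: zeros_def)
  ultimately show ?thesis by (simp add: card_Un_disjoint card_image inj_on_def)
qed

lemma zeros_excursion: "w \<in> excursions L V \<Longrightarrow> zeros w = {length w}"
proof (intro equalityI subsetI)
  fix j assume w: "w \<in> excursions L V" and j: "j \<in> zeros w"
  then have "\<not> j \<in> {0<..<length w}" by (auto simp: zeros_def excursions_def)
  then show "j \<in> {length w}" using j by (auto simp: zeros_def)
next
  fix j assume "w \<in> excursions L V" "j \<in> {length w}"
  then show "j \<in> zeros w" by (cases w) (auto simp: zeros_def excursions_def)
qed

lemma card_zeros_loops: "w \<in> loops L V k \<Longrightarrow> card (zeros w) = k"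
proof (induction k arbitrary: w)
  case 0
  then show ?case by (simp add: zeros_def)
next
  case (Suc k)
  then obtain v u where w: "w = v @ u" "v \<in> loops L V k" "u \<in> excursions (L k) V" by auto
  then show ?case using Suc.IH[OF w(2)] zeros_append[OF loops_sum[OF w(2)]] zeros_excursion[OF w(3)] by simp
qed

text \<open>The word \<open>w\<close> consists of the excursions completed by time \<open>l\<close>; excursion number \<open>i\<close> is in
progress.\<close>

lemma loops_alive:
  assumes "v \<in> loops L V k" "l < length v"
  shows "\<exists>i<k. \<exists>w\<in>loops L V i. \<exists>w'. v = w @ w' \<and> length w \<le> l \<and> l < length w + L i"
  using assms
proof (induction k arbitrary: v)
  case (Suc k)
  then obtain v' u where v: "v = v' @ u" "v' \<in> loops L V k" "u \<in> excursions (L k) V" by auto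
  show ?case
  proof (cases "l < length v'")
    case True
    then obtain i w w' where "i < k" "w \<in> loops L V i" "v' = w @ w'" "length w \<le> l" "l < length w + L i"
      using Suc.IH[OF v(2)] by blast
    then show ?thesis using v by (intro exI[of _ i]) auto
  next
    case False
    have "length u \<le> L k" using v by (simp add: excursions_def)
    then show ?thesis using False Suc.prems v by (intro exI[of _ k]) auto
  qed
qed simp

text \<open>Each word \<open>w\<close> is counted for the \<open>L i\<close> values of \<open>l\<close> that follow its length.\<close>

lemma sum_alive_le:
  fixes V :: "(int ^ 'd) set"
  shows "(\<Sum>l<N. weight {w \<in> loops L V i. length w \<le> l \<and> l < length w + L i}) \<le> weight (loops L V i) * real (L i)"
proof -
  let ?p = "step_prob TYPE('d)"
  have "(\<Sum>l<N. weight {w \<in> loops L V i. length w \<le> l \<and> l < length w + L i})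
      = (\<Sum>l<N. \<Sum>w\<in>loops L V i. if length w \<le> l \<and> l < length w + L i then ?p ^ length w else 0)"
    unfolding weight_def by (intro sum.cong refl sum.inter_filter) simp
  also have "\<dots> = (\<Sum>w\<in>loops L V i. \<Sum>l<N. if length w \<le> l \<and> l < length w + L i then ?p ^ length w else 0)"
    by (rule sum.swap)
  also have "\<dots> \<le> (\<Sum>w\<in>loops L V i. ?p ^ length w * real (L i))"
  proof (rule sum_mono)
    fix w :: "(int ^ 'd) list"
    have "(\<Sum>l<N. if length w \<le> l \<and> l < length w + L i then ?p ^ length w else 0)
        = (\<Sum>l\<in>{l\<in>{..<N}. length w \<le> l \<and> l < length w + L i}. ?p ^ length w)"
      by (rule sum.inter_filter[symmetric]) simp
    also have "\<dots> \<le> (\<Sum>l\<in>{length w..<length w + L i}. ?p ^ length w)"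
      using step_prob_pos[where 'd = 'd] by (intro sum_mono2) auto
    also have "\<dots> = ?p ^ length w * real (L i)" by simp
    finally show "(\<Sum>l<N. if length w \<le> l \<and> l < length w + L i then ?p ^ length w else 0)
        \<le> ?p ^ length w * real (L i)" .
  qed
  finally show ?thesis by (simp add: weight_def sum_distrib_right)
qed

definition paths_to :: "nat set \<Rightarrow> int ^ 'd \<Rightarrow> (int ^ 'd) list set" where
  "paths_to I y = (\<Union>l\<in>I. {w \<in> words l. sum_list w = y})"

lemma finite_paths_to [simp]: "finite I \<Longrightarrow> finite (paths_to I y)"
  unfolding paths_to_def by (intro finite_UN_I finite_subset[OF _ finite_words]) auto

lemma weight_paths_to: "finite I \<Longrightarrow> weight (paths_to I y) = (\<Sum>l\<in>I. heat l y)"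
  unfolding weight_def paths_to_def heat_def
proof (rule sum.UNION_disjoint)
  show "\<forall>l\<in>I. finite {w \<in> words l. sum_list w = y}" by (intro ballI finite_subset[OF _ finite_words]) auto
qed (auto simp: words_def)

text \<open>The probability of a return within \<open>L\<close> steps.\<close>

definition return_weight :: "'d::finite itself \<Rightarrow> nat \<Rightarrow> real" where
  "return_weight _ L = weight (excursions L {} :: (int ^ 'd) list set)"

lemma return_weight_nonneg: "return_weight TYPE('d::finite) L \<ge> 0"
  by (simp add: return_weight_def weight_nonneg)

lemma return_weight_mono: "L \<le> L' \<Longrightarrow> return_weight TYPE('d::finite) L \<le> return_weight TYPE('d) L'"
  unfolding return_weight_def by (intro weight_mono excursions_mono) auto

text \<open>The paths of length at most \<open>L'\<close> that return for the first time after time \<open>L\<close> are among the closed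
paths of such a length.\<close>

lemma return_weight_le_tail:
  "return_weight TYPE('d::finite) L' \<le> return_weight TYPE('d) L + (\<Sum>l\<in>{L<..L'}. heat l (0 :: int ^ 'd))"
proof -
  have "return_weight TYPE('d) L' \<le> weight (excursions L {} \<union> paths_to {L<..L'} (0 :: int ^ 'd))"
    unfolding return_weight_def
  proof (rule weight_mono)
    show "excursions L' {} \<subseteq> excursions L {} \<union> paths_to {L<..L'} (0 :: int ^ 'd)"
      by (auto simp: excursions_def paths_to_def words_def)
  qed simp
  also have "\<dots> \<le> return_weight TYPE('d) L + weight (paths_to {L<..L'} (0 :: int ^ 'd))"
    unfolding return_weight_def by (intro weight_Un_le) auto
  finally show ?thesis by (simp add: weight_paths_to)
qed

text \<open>An excursion through \<open>x\<close> is a path from \<open>0\<close> to \<open>x\<close> followed by a path from \<open>x\<close> to \<open>0\<close>, which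
contributes the product of two Green functions.\<close>

lemma return_weight_le_avoid:
  fixes x :: "int ^ 'd"
  assumes x: "x \<noteq> 0"
  shows "return_weight TYPE('d) L \<le> weight (excursions L {x})
      + (\<Sum>l\<in>{0<..L}. heat l x) * (\<Sum>l\<in>{0<..L}. heat l (- x))"
proof -
  let ?P = "(\<lambda>(v, w). v @ w) ` (paths_to {0<..L} x \<times> paths_to {0<..L} (- x))"
  have sub: "excursions L {} \<subseteq> excursions L {x} \<union> ?P"
  proof
    fix w :: "(int ^ 'd) list" assume w: "w \<in> excursions L {}"
    show "w \<in> excursions L {x} \<union> ?P"
    proof (cases "w \<in> excursions L {x}")
      case False
      then obtain j where j: "j \<le> length w" "sum_list (take j w) = x"
        using w by (auto simp: excursions_def)
      have j0: "j > 0" using j x by (cases j) auto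
      have sum: "sum_list (take j w) + sum_list (drop j w) = 0"
        using w by (simp add: excursions_def flip: sum_list_append)
      have jl: "j < length w"
      proof (rule ccontr)
        assume "\<not> j < length w"
        then have "sum_list (take j w) = 0" using w j by (simp add: excursions_def)
        then show False using j x by simp
      qed
      have "take j w \<in> paths_to {0<..L} x"
        using w j j0 by (auto simp: paths_to_def words_def excursions_def dest: in_set_takeD)
      moreover have "sum_list (drop j w) = - x" using sum j by (simp add: add_eq_0_iff)
      then have "drop j w \<in> paths_to {0<..L} (- x)"
        using w jl by (auto simp: paths_to_def words_def excursions_def dest: in_set_dropD)
      ultimately have "(\<lambda>(v, w). v @ w) (take j w, drop j w) \<in> ?P" by (intro imageI) auto
      then show ?thesis by simp
    qed simp
  qed
  have "return_weight TYPE('d) L \<le> weight (excursions L {x} \<union> ?P)"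
    unfolding return_weight_def by (rule weight_mono[OF _ sub]) simp
  also have "\<dots> \<le> weight (excursions L {x}) + weight ?P" by (intro weight_Un_le) auto
  also have "weight ?P \<le> weight (paths_to {0<..L} x) * weight (paths_to {0<..L} (- x))"
    by (intro weight_append_le) auto
  finally show ?thesis by (simp add: weight_paths_to)
qed

text \<open>Loops made of different numbers of excursions are different closed paths, since the number of
excursions is the number of returns. So the left side counts some of the closed paths only once.\<close>

lemma sum_return_weight_powers_le:
  "(\<Sum>k<K. return_weight TYPE('d::finite) L ^ k) \<le> (\<Sum>l\<le>K * L. heat l (0 :: int ^ 'd))"
proof -
  let ?A = "\<lambda>k. loops (\<lambda>_. L) {} k :: (int ^ 'd) list set"
  have len: "length w \<le> k * L" if "w \<in> ?A k" for w k
    using that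
  proof (induction k arbitrary: w)
    case (Suc k)
    then show ?case by (fastforce simp: excursions_def)
  qed simp
  have "(\<Sum>k<K. return_weight TYPE('d) L ^ k) = (\<Sum>k<K. weight (?A k))"
    by (simp add: weight_loops return_weight_def)
  also have "\<dots> = weight (\<Union>k<K. ?A k)"
    unfolding weight_def
  proof (rule sum.UNION_disjoint[symmetric])
    show "\<forall>i\<in>{..<K}. \<forall>j\<in>{..<K}. i \<noteq> j \<longrightarrow> ?A i \<inter> ?A j = {}"
      using card_zeros_loops by blast
  qed auto
  also have "\<dots> \<le> weight (paths_to {..K * L} (0 :: int ^ 'd))"
  proof (rule weight_mono)
    show "(\<Union>k<K. ?A k) \<subseteq> paths_to {..K * L} 0"
    proof
      fix w assume "w \<in> (\<Union>k<K. ?A k)"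
      then obtain k where k: "k < K" "w \<in> ?A k" by auto
      have "k * L \<le> K * L" using k by simp
      then have "length w \<le> K * L" using len[OF k(2)] by linarith
      then show "w \<in> paths_to {..K * L} 0"
        using loops_sum[OF k(2)] loops_steps[OF k(2)] by (auto simp: paths_to_def words_def)
    qed
  qed simp
  finally show ?thesis by (simp add: weight_paths_to)
qed

text \<open>Transience. The expected number of returns is finite for \<open>d \<ge> 3\<close>, and it dominates the geometric
series of the return probability.\<close>

lemma return_weight_limit_less_1:
  assumes d: "CARD('d::finite) \<ge> 3" and lim: "return_weight TYPE('d) \<longlonglongrightarrow> q"
  shows "q < 1"
proof (rule ccontr)
  assume "\<not> q < 1"
  define G where "G = 2 + heat_const TYPE('d) + 2 * heat_const TYPE('d)"
  have bound: "(\<Sum>k<K. return_weight TYPE('d) L ^ k) \<le> G" for K L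
  proof -
    have "(\<Sum>l\<le>N. heat l (0 :: int ^ 'd)) \<le> G" for N
    proof -
      have "(\<Sum>l\<le>N. heat l (0 :: int ^ 'd)) \<le> (\<Sum>l\<in>{0, 1} \<union> {1<..N}. heat l (0 :: int ^ 'd))"
        by (intro sum_mono2 heat_nonneg) auto
      also have "\<dots> = heat 0 (0 :: int ^ 'd) + heat 1 (0 :: int ^ 'd) + (\<Sum>l\<in>{1<..N}. heat l (0 :: int ^ 'd))"
        by (subst sum.union_disjoint) auto
      also have "\<dots> \<le> G"
        using heat_le[of 1 "0 :: int ^ 'd"] return_tail[OF d, of 1 "0" N] by (simp add: G_def heat_0)
      finally show ?thesis .
    qed
    then show ?thesis using sum_return_weight_powers_le[where 'd = 'd, of L K] order_trans by blast
  qed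
  have "(\<Sum>k<K. q ^ k) \<le> G" for K
  proof (rule LIMSEQ_le_const2)
    show "(\<lambda>L. \<Sum>k<K. return_weight TYPE('d) L ^ k) \<longlonglongrightarrow> (\<Sum>k<K. q ^ k)"
      by (intro tendsto_intros lim)
  qed (use bound in blast)
  moreover have "real K \<le> (\<Sum>k<K. q ^ k)" for K
  proof -
    have "(\<Sum>k<K. 1) \<le> (\<Sum>k<K. q ^ k)"
      using \<open>\<not> q < 1\<close> by (intro sum_mono one_le_power) auto
    then show ?thesis by simp
  qed
  ultimately have "real K \<le> G" for K by (meson order_trans)
  then show False using reals_Archimedean2[of G] by (meson not_le)
qed

section \<open>Second moments and infinitely many successes\<close>

text \<open>Chebyshev's inequality for the number of events that occur: its variance is at most
\<open>\<mu> + 2 * C * \<mu>\<close>, the diagonal terms contributing \<open>\<mu>\<close> and each pair of events being counted twice.\<close>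

lemma (in prob_space) prob_none_le_second_moment:
  fixes I :: "nat set"
  assumes I: "finite I" and B: "\<And>n. n \<in> I \<Longrightarrow> B n \<in> events"
    and \<mu>: "\<mu> = (\<Sum>n\<in>I. prob (B n))" "\<mu> > 0"
    and corr: "(\<Sum>m\<in>I. \<Sum>n\<in>{n\<in>I. n < m}. prob (B n \<inter> B m) - prob (B n) * prob (B m)) \<le> C * \<mu>"
  shows "prob (space M - (\<Union>n\<in>I. B n)) \<le> (1 + 2 * C) / \<mu>"
proof -
  let ?Z = "\<lambda>\<omega>. \<Sum>n\<in>I. indicat_real (B n) \<omega>"
  have EZ: "expectation ?Z = \<mu>"
    unfolding \<mu> using B
    by (subst Bochner_Integration.integral_sum)
      (auto simp: Int_absorb1 sets.sets_into_space emeasure_eq_measure intro!: integrable_real_indicator)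
  have intZZ: "integrable M (\<lambda>\<omega>. indicat_real (B n \<inter> B m) \<omega>)" if "n \<in> I" "m \<in> I" for n m
    using B that by (intro integrable_real_indicator) (auto simp: emeasure_eq_measure)
  have sq: "(?Z \<omega> - \<mu>)\<^sup>2 = (\<Sum>m\<in>I. \<Sum>n\<in>I. indicat_real (B n \<inter> B m) \<omega>) - 2 * \<mu> * ?Z \<omega> + \<mu>\<^sup>2" for \<omega>
  proof -
    have "?Z \<omega> * ?Z \<omega> = (\<Sum>m\<in>I. \<Sum>n\<in>I. indicat_real (B n \<inter> B m) \<omega>)"
      unfolding sum_product indicator_inter_arith by (simp add: mult.commute)
    moreover have "(z - \<mu>)\<^sup>2 = z * z - 2 * \<mu> * z + \<mu>\<^sup>2" for z :: real
      by (simp add: power2_eq_square algebra_simps)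
    ultimately show ?thesis by (simp only:)
  qed
  have intsq: "integrable M (\<lambda>\<omega>. (?Z \<omega> - \<mu>)\<^sup>2)"
    unfolding sq using B intZZ
    by (intro Bochner_Integration.integrable_add Bochner_Integration.integrable_diff Bochner_Integration.integrable_sum)
      (auto simp: emeasure_eq_measure)
  have "expectation (\<lambda>\<omega>. (?Z \<omega> - \<mu>)\<^sup>2)
      = expectation (\<lambda>\<omega>. \<Sum>m\<in>I. \<Sum>n\<in>I. indicat_real (B n \<inter> B m) \<omega>) - 2 * \<mu> * expectation ?Z + \<mu>\<^sup>2"
    unfolding sq using B intZZ
    by (subst Bochner_Integration.integral_add Bochner_Integration.integral_diff;
        (intro Bochner_Integration.integrable_add Bochner_Integration.integrable_diff Bochner_Integration.integrable_sum)?;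
        auto simp: emeasure_eq_measure prob_space)+
  also have "expectation (\<lambda>\<omega>. \<Sum>m\<in>I. \<Sum>n\<in>I. indicat_real (B n \<inter> B m) \<omega>)
      = (\<Sum>m\<in>I. \<Sum>n\<in>I. prob (B n \<inter> B m))"
  proof -
    have "expectation (\<lambda>\<omega>. \<Sum>m\<in>I. \<Sum>n\<in>I. indicat_real (B n \<inter> B m) \<omega>)
        = (\<Sum>m\<in>I. \<Sum>n\<in>I. expectation (\<lambda>\<omega>. indicat_real (B n \<inter> B m) \<omega>))"
      using intZZ by (subst Bochner_Integration.integral_sum; (intro Bochner_Integration.integrable_sum)?; simp)+
    also have "\<dots> = (\<Sum>m\<in>I. \<Sum>n\<in>I. prob (B n \<inter> B m))"
      using B by (intro sum.cong refl) (simp add: Int_absorb1 sets.sets_into_space)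
    finally show ?thesis .
  qed
  finally have var: "expectation (\<lambda>\<omega>. (?Z \<omega> - \<mu>)\<^sup>2) = (\<Sum>m\<in>I. \<Sum>n\<in>I. prob (B n \<inter> B m)) - \<mu>\<^sup>2"
    unfolding EZ by (simp add: power2_eq_square)
  let ?c = "\<lambda>n m. prob (B n \<inter> B m) - prob (B n) * prob (B m)"
  have "(\<Sum>m\<in>I. \<Sum>n\<in>I. prob (B n \<inter> B m)) - \<mu>\<^sup>2 = (\<Sum>m\<in>I. \<Sum>n\<in>I. ?c n m)"
    unfolding \<mu> power2_eq_square sum_product sum_subtractf by (simp add: mult.commute)
  also have "\<dots> = (\<Sum>m\<in>I. (\<Sum>n\<in>{n\<in>I. n < m}. ?c n m) + (\<Sum>n\<in>{n\<in>I. m < n}. ?c n m) + ?c m m)"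
  proof (rule sum.cong[OF refl])
    fix m assume m: "m \<in> I"
    have "I = insert m ({n\<in>I. n < m} \<union> {n\<in>I. m < n})" using m by auto
    then have "(\<Sum>n\<in>I. ?c n m) = (\<Sum>n\<in>insert m ({n\<in>I. n < m} \<union> {n\<in>I. m < n}). ?c n m)" by simp
    also have "\<dots> = ?c m m + (\<Sum>n\<in>{n\<in>I. n < m} \<union> {n\<in>I. m < n}. ?c n m)"
      using I by (subst sum.insert) auto
    also have "(\<Sum>n\<in>{n\<in>I. n < m} \<union> {n\<in>I. m < n}. ?c n m) = (\<Sum>n\<in>{n\<in>I. n < m}. ?c n m) + (\<Sum>n\<in>{n\<in>I. m < n}. ?c n m)"
      using I by (intro sum.union_disjoint) auto
    finally show "(\<Sum>n\<in>I. ?c n m) = (\<Sum>n\<in>{n\<in>I. n < m}. ?c n m) + (\<Sum>n\<in>{n\<in>I. m < n}. ?c n m) + ?c m m"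
      by simp
  qed
  also have "\<dots> = (\<Sum>m\<in>I. \<Sum>n\<in>{n\<in>I. n < m}. ?c n m) + (\<Sum>m\<in>I. \<Sum>n\<in>{n\<in>I. m < n}. ?c n m) + (\<Sum>m\<in>I. ?c m m)"
    by (simp add: sum.distrib)
  also have "(\<Sum>m\<in>I. \<Sum>n\<in>{n\<in>I. m < n}. ?c n m) = (\<Sum>n\<in>I. \<Sum>m\<in>{m\<in>I. m < n}. ?c n m)"
    using sum.swap_restrict[OF I I, of "\<lambda>m n. ?c n m" "\<lambda>m n. m < n"] .
  also have "\<dots> = (\<Sum>m\<in>I. \<Sum>n\<in>{n\<in>I. n < m}. ?c n m)"
    by (intro sum.cong refl) (simp add: Int_commute mult.commute)
  also have "(\<Sum>m\<in>I. ?c m m) \<le> \<mu>"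
    unfolding \<mu> by (intro sum_mono) simp
  finally have varle: "expectation (\<lambda>\<omega>. (?Z \<omega> - \<mu>)\<^sup>2) \<le> (1 + 2 * C) * \<mu>"
    using corr unfolding var by (simp add: algebra_simps)
  let ?N = "space M - (\<Union>n\<in>I. B n)"
  have N: "?N \<in> events" using B I by auto
  have "\<mu>\<^sup>2 * prob ?N = expectation (\<lambda>\<omega>. \<mu>\<^sup>2 * indicat_real ?N \<omega>)"
    using N by (simp add: Int_absorb1)
  also have "\<dots> \<le> expectation (\<lambda>\<omega>. (?Z \<omega> - \<mu>)\<^sup>2)"
  proof (rule integral_mono)
    show "integrable M (\<lambda>\<omega>. \<mu>\<^sup>2 * indicat_real ?N \<omega>)"
      using N by (auto simp: emeasure_eq_measure)
    fix \<omega> assume "\<omega> \<in> space M"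
    show "\<mu>\<^sup>2 * indicat_real ?N \<omega> \<le> (?Z \<omega> - \<mu>)\<^sup>2"
    proof (cases "\<omega> \<in> ?N")
      case True
      then have "?Z \<omega> = 0" by (intro sum.neutral) auto
      then show ?thesis using True by simp
    qed simp
  qed (rule intsq)
  also have "\<dots> \<le> (1 + 2 * C) * \<mu>" by (rule varle)
  finally have "(prob ?N * \<mu>) * \<mu> \<le> (1 + 2 * C) * \<mu>"
    by (simp only: power2_eq_square mult_ac)
  then have "prob ?N * \<mu> \<le> 1 + 2 * C" using \<mu>(2) by (simp only: mult_le_cancel_right_pos)
  then show ?thesis using \<mu>(2) by (simp only: pos_le_divide_eq)
qed

text \<open>A substitute for the second Borel-Cantelli lemma when the events \<open>B n\<close> are weakly correlated and each
is spoiled by \<open>D n\<close> with a relative probability tending to \<open>0\<close>. A late range of indices with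
expected number of events between \<open>s\<close> and \<open>s + 1\<close> contains an unspoiled event up to
probability \<open>O(1 / s)\<close>, and \<open>s\<close> is arbitrary.\<close>

lemma (in prob_space) infinitely_often_second_moment:
  fixes B D :: "nat \<Rightarrow> 'a set" and p g :: "nat \<Rightarrow> real"
  assumes B: "\<And>n. B n \<in> events" and D: "\<And>n. D n \<in> events"
    and p: "\<And>n. prob (B n) = p n"
    and corr: "\<And>N m. (\<Sum>n\<in>{N..<m}. prob (B n \<inter> B m) - p n * p m) \<le> C * p m"
    and div: "\<And>N s. \<exists>N'. s \<le> (\<Sum>n\<in>{N..<N'}. p n)"
    and bad: "eventually (\<lambda>n. prob (D n) \<le> p n * g n) sequentially"
    and g: "g \<longlonglongrightarrow> 0" and C: "C \<ge> 0"
  shows "AE \<omega> in M. \<exists>\<^sub>\<infinity>n. \<omega> \<in> B n - D n"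
proof -
  have p01: "0 \<le> p n" "p n \<le> 1" for n using p[of n] by (metis measure_nonneg, metis prob_le_1)
  have one: "prob (\<Union>n\<in>{N0..}. B n - D n) = 1" for N0
  proof -
    let ?U = "\<Union>n\<in>{N0..}. B n - D n"
    have U: "?U \<in> events" using B D by (intro sets.countable_UN') auto
    have stage: "1 - prob ?U \<le> (3 + 2 * C) / s" if s: "s \<ge> 1" for s
    proof -
      have "eventually (\<lambda>n. g n < 1 / s\<^sup>2) sequentially"
        using s by (intro order_tendstoD(2)[OF g]) auto
      then have "eventually (\<lambda>n. g n < 1 / s\<^sup>2 \<and> prob (D n) \<le> p n * g n) sequentially"
        using bad by eventually_elim auto
      then obtain N1 where N1: "\<And>n. n \<ge> N1 \<Longrightarrow> g n < 1 / s\<^sup>2 \<and> prob (D n) \<le> p n * g n"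
        by (auto simp: eventually_sequentially)
      \<comment> \<open>First \<open>N\<close> is taken so large that spoiling is rare on the scale of \<open>s\<close>; then the range is closed as soon as it carries enough weight.\<close>
      define N where "N = max N0 N1"
      define N' where "N' = (LEAST N'. s \<le> (\<Sum>n\<in>{N..<N'}. p n))"
      let ?I = "{N..<N'}"
      let ?\<mu> = "\<Sum>n\<in>?I. p n"
      have \<mu>: "s \<le> ?\<mu>" unfolding N'_def by (rule LeastI_ex[OF div])
      have \<mu>': "?\<mu> \<le> s + 1"
      proof -
        have "N < N'" using \<mu> s by (cases "N < N'") auto
        then obtain N2 where N2: "N' = Suc N2" "N \<le> N2" by (cases N') auto
        have "\<not> s \<le> (\<Sum>n\<in>{N..<N2}. p n)"
          using not_less_Least[of N2 "\<lambda>N'. s \<le> (\<Sum>n\<in>{N..<N'}. p n)"] N2 by (auto simp: N'_def)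
        then show ?thesis using N2 p01[of N2] by simp
      qed
      have "prob (space M - (\<Union>n\<in>?I. B n)) \<le> (1 + 2 * C) / ?\<mu>"
      proof (rule prob_none_le_second_moment)
        show "?\<mu> = (\<Sum>n\<in>?I. prob (B n))" by (simp add: p)
        have "(\<Sum>m\<in>?I. \<Sum>n\<in>{n\<in>?I. n < m}. prob (B n \<inter> B m) - prob (B n) * prob (B m)) \<le> (\<Sum>m\<in>?I. C * p m)"
        proof (rule sum_mono)
          fix m assume "m \<in> ?I"
          then have "{n\<in>?I. n < m} = {N..<m}" by auto
          then show "(\<Sum>n\<in>{n\<in>?I. n < m}. prob (B n \<inter> B m) - prob (B n) * prob (B m)) \<le> C * p m"
            using corr[of m N] by (simp add: p)
        qed
        then show "(\<Sum>m\<in>?I. \<Sum>n\<in>{n\<in>?I. n < m}. prob (B n \<inter> B m) - prob (B n) * prob (B m)) \<le> C * ?\<mu>"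
          by (simp add: sum_distrib_left)
      qed (use \<mu> s B in auto)
      also have "\<dots> \<le> (1 + 2 * C) / s" using \<mu> s C by (intro divide_left_mono) auto
      finally have miss: "prob (space M - (\<Union>n\<in>?I. B n)) \<le> (1 + 2 * C) / s" .
      have "prob (\<Union>n\<in>?I. D n) \<le> (\<Sum>n\<in>?I. prob (D n))"
        using D by (intro finite_measure_subadditive_finite) auto
      also have "\<dots> \<le> (\<Sum>n\<in>?I. p n * (1 / s\<^sup>2))"
      proof (rule sum_mono)
        fix n assume "n \<in> ?I"
        then have "g n < 1 / s\<^sup>2" "prob (D n) \<le> p n * g n" using N1[of n] by (auto simp: N_def)
        then show "prob (D n) \<le> p n * (1 / s\<^sup>2)"
          using p01[of n] by (meson less_imp_le mult_left_mono order_trans)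
      qed
      also have "\<dots> = ?\<mu> * (1 / s\<^sup>2)" by (rule sum_distrib_right[symmetric])
      also have "\<dots> \<le> (2 * s) * (1 / s\<^sup>2)" using \<mu>' s by (intro mult_right_mono) auto
      also have "\<dots> = 2 / s" using s by (simp add: power2_eq_square)
      finally have spoil: "prob (\<Union>n\<in>?I. D n) \<le> 2 / s" .
      have "1 = prob (space M)" by (simp add: prob_space)
      also have "\<dots> \<le> prob ((space M - (\<Union>n\<in>?I. B n)) \<union> ((\<Union>n\<in>?I. D n) \<union> ?U))"
        using B D U by (intro finite_measure_mono) (auto simp: N_def)
      also have "\<dots> \<le> prob (space M - (\<Union>n\<in>?I. B n)) + prob ((\<Union>n\<in>?I. D n) \<union> ?U)"
        using B D U by (intro measure_Un_le) auto
      also have "prob ((\<Union>n\<in>?I. D n) \<union> ?U) \<le> prob (\<Union>n\<in>?I. D n) + prob ?U"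
        using B D U by (intro measure_Un_le) auto
      finally have "1 - prob ?U \<le> (1 + 2 * C) / s + 2 / s" using miss spoil by linarith
      then show ?thesis by (simp flip: add_divide_distrib)
    qed
    have "((\<lambda>s. (3 + 2 * C) / s) \<longlongrightarrow> 0) at_top"
      by (intro tendsto_divide_0[OF tendsto_const] filterlim_at_top_imp_at_infinity filterlim_ident)
    moreover have "eventually (\<lambda>s. 1 - prob ?U \<le> (3 + 2 * C) / s) at_top"
      using eventually_ge_at_top[of 1] by eventually_elim (rule stage)
    ultimately have "1 - prob ?U \<le> 0"
      by (rule tendsto_lowerbound) simp
    then show ?thesis using prob_le_1[of ?U] by linarith
  qed
  have "AE \<omega> in M. \<forall>N0. \<omega> \<in> (\<Union>n\<in>{N0..}. B n - D n)"
    unfolding AE_all_countable using AE_prob_1[OF one] by blast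
  then show ?thesis
    by eventually_elim (auto simp: INFM_nat_le)
qed

section \<open>The random walk read as words\<close>

locale lattice_walk = prob_space M for M :: "'a measure" +
  fixes X :: "nat \<Rightarrow> 'a \<Rightarrow> int ^ 'd"
  assumes indep: "indep_vars (\<lambda>_. count_space UNIV) X {1..}"
    and step: "k \<ge> 1 \<Longrightarrow> e \<in> unit_steps \<Longrightarrow> prob {\<omega> \<in> space M. X k \<omega> = e} = step_prob TYPE('d)"
begin

lemma X_measurable [measurable]: "k \<ge> 1 \<Longrightarrow> X k \<in> M \<rightarrow>\<^sub>M count_space UNIV"
  using indep unfolding indep_vars_def by auto

lemma X_event: "k \<ge> 1 \<Longrightarrow> {\<omega> \<in> space M. X k \<omega> = e} \<in> events"
  using measurable_sets[OF X_measurable, of k "{e}"] by (simp add: vimage_def Int_def conj_commute)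

text \<open>The steps are unit vectors only almost surely; on this event every piece of the trajectory is a
word.\<close>

definition proper :: "'a set" where
  "proper = {\<omega> \<in> space M. \<forall>k\<ge>1. X k \<omega> \<in> unit_steps}"

lemma AE_proper: "AE \<omega> in M. \<omega> \<in> proper"
proof -
  have "AE \<omega> in M. X k \<omega> \<in> unit_steps" if k: "k \<ge> 1" for k
  proof -
    have "prob (\<Union>e\<in>unit_steps. {\<omega> \<in> space M. X k \<omega> = e}) = (\<Sum>e\<in>unit_steps. prob {\<omega> \<in> space M. X k \<omega> = e})"
      using k by (intro finite_measure_finite_Union) (auto simp: disjoint_family_on_def X_event)
    also have "\<dots> = (\<Sum>e\<in>(unit_steps :: (int ^ 'd) set). step_prob TYPE('d))"
      by (intro sum.cong refl step k)
    also have "\<dots> = 1" using card_unit_steps[where 'd = 'd] by simp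
    also have "(\<Union>e\<in>unit_steps. {\<omega> \<in> space M. X k \<omega> = e}) = {\<omega> \<in> space M. X k \<omega> \<in> unit_steps}" by auto
    finally have "prob {\<omega> \<in> space M. X k \<omega> \<in> unit_steps} = 1" .
    from AE_prob_1[OF this] show ?thesis by simp
  qed
  then have "AE \<omega> in M. \<forall>k. k \<ge> 1 \<longrightarrow> X k \<omega> \<in> unit_steps" by (simp add: AE_all_countable)
  then show ?thesis by (auto simp: proper_def)
qed

lemma prob_cylinder:
  assumes J: "finite J" "J \<subseteq> {1..}" and f: "\<And>j. j \<in> J \<Longrightarrow> f j \<in> unit_steps"
  shows "prob {\<omega> \<in> space M. \<forall>j\<in>J. X j \<omega> = f j} = step_prob TYPE('d) ^ card J"
proof (cases "J = {}")
  case True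
  then show ?thesis by (simp add: prob_space)
next
  case False
  have "{\<omega> \<in> space M. \<forall>j\<in>J. X j \<omega> = f j} = (\<Inter>j\<in>J. X j -` {f j} \<inter> space M)"
    using False by auto
  then have "prob {\<omega> \<in> space M. \<forall>j\<in>J. X j \<omega> = f j} = (\<Prod>j\<in>J. prob (X j -` {f j} \<inter> space M))"
    using indep_varsD[OF indep False J(1,2)] by simp
  also have "\<dots> = (\<Prod>j\<in>J. step_prob TYPE('d))"
  proof (rule prod.cong[OF refl])
    fix j assume j: "j \<in> J"
    have "X j -` {f j} \<inter> space M = {\<omega> \<in> space M. X j \<omega> = f j}" by auto
    then show "prob (X j -` {f j} \<inter> space M) = step_prob TYPE('d)" using step[of j "f j"] j J f by auto
  qed
  finally show ?thesis by simp
qed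

definition reads :: "nat \<Rightarrow> (int ^ 'd) list \<Rightarrow> 'a set" where
  "reads n w = {\<omega> \<in> space M. \<forall>j<length w. X (Suc (n + j)) \<omega> = w ! j}"

lemma reads_event [measurable]: "reads n w \<in> events"
proof -
  have "reads n w = space M \<inter> (\<Inter>j\<in>{..<length w}. {\<omega> \<in> space M. X (Suc (n + j)) \<omega> = w ! j})"
    by (auto simp: reads_def)
  also have "\<dots> \<in> events"
    by (cases "length w = 0") (auto intro!: sets.Int sets.finite_INT X_event simp: lessThan_empty_iff)
  finally show ?thesis .
qed

lemma prob_reads_pair:
  assumes v: "set v \<subseteq> unit_steps" and w: "set w \<subseteq> unit_steps" and nm: "n + length v \<le> m"
  shows "prob (reads n v \<inter> reads m w) = step_prob TYPE('d) ^ length v * step_prob TYPE('d) ^ length w"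
proof -
  let ?J1 = "(\<lambda>j. Suc (n + j)) ` {..<length v}" and ?J2 = "(\<lambda>j. Suc (m + j)) ` {..<length w}"
  let ?f = "\<lambda>j. if j \<le> n + length v then v ! (j - Suc n) else w ! (j - Suc m)"
  have eq: "reads n v \<inter> reads m w = {\<omega> \<in> space M. \<forall>j\<in>?J1 \<union> ?J2. X j \<omega> = ?f j}"
    using nm by (auto simp: reads_def ball_Un)
  have "prob (reads n v \<inter> reads m w) = step_prob TYPE('d) ^ card (?J1 \<union> ?J2)"
    unfolding eq using v w nm by (intro prob_cylinder) (auto simp: subset_iff)
  also have "card (?J1 \<union> ?J2) = card ?J1 + card ?J2"
    using nm by (intro card_Un_disjoint) auto
  also have "\<dots> = length v + length w"
    by (simp add: card_image inj_on_def)
  finally show ?thesis by (simp add: power_add)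
qed

lemma prob_reads: "set w \<subseteq> unit_steps \<Longrightarrow> prob (reads n w) = step_prob TYPE('d) ^ length w"
proof -
  assume "set w \<subseteq> unit_steps"
  moreover have "reads (n + length w) [] = space M" by (auto simp: reads_def)
  moreover have "reads n w \<inter> space M = reads n w" by (auto simp: reads_def)
  ultimately show ?thesis using prob_reads_pair[of w "[]" n "n + length w"] by simp
qed

definition starts :: "nat \<Rightarrow> (int ^ 'd) list set \<Rightarrow> 'a set" where
  "starts n A = (\<Union>w\<in>A. reads n w)"

lemma starts_event [measurable]: "finite A \<Longrightarrow> starts n A \<in> events"
  unfolding starts_def by (intro sets.finite_UN reads_event)

text \<open>Along one trajectory at most one word of a prefix-free set is read, so the events are disjoint.\<close>

lemma prob_starts:
  assumes A: "finite A" "prefix_free A" "\<And>w. w \<in> A \<Longrightarrow> set w \<subseteq> unit_steps"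
  shows "prob (starts n A) = weight A"
proof -
  have *: "reads n v \<inter> reads n w = {}" if "v \<in> A" "w \<in> A" "v \<noteq> w" "length v \<le> length w" for v w
  proof (rule ccontr)
    assume "reads n v \<inter> reads n w \<noteq> {}"
    then obtain \<omega> where "\<omega> \<in> reads n v" "\<omega> \<in> reads n w" by auto
    then have "take (length v) w = v"
      using that(4) by (intro nth_equalityI) (auto simp: reads_def min_absorb2)
    then have "v @ drop (length v) w = w @ []" by (metis append_take_drop_id append_Nil2)
    then show False using A(2) that unfolding prefix_free_def by blast
  qed
  have "disjoint_family_on (reads n) A"
    unfolding disjoint_family_on_def using * by (metis Int_commute nle_le)
  then have "prob (starts n A) = (\<Sum>w\<in>A. prob (reads n w))"
    unfolding starts_def using A by (intro finite_measure_finite_Union) auto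
  also have "\<dots> = weight A" unfolding weight_def using A by (intro sum.cong refl prob_reads)
  finally show ?thesis .
qed

text \<open>Union bound for two words read on disjoint time intervals. The positions \<open>s\<close> and \<open>m\<close> may depend on the
first word, which covers both a word ending at a given time and a word starting where the first
one ends.\<close>

lemma prob_pairs_le:
  assumes A: "finite A" "\<And>w. w \<in> A \<Longrightarrow> set w \<subseteq> unit_steps"
    and B: "finite B" "\<And>w. w \<in> B \<Longrightarrow> set w \<subseteq> unit_steps"
    and sep: "\<And>w. w \<in> A \<Longrightarrow> s w + length w \<le> m w"
  shows "prob (\<Union>w\<in>A. \<Union>v\<in>B. reads (s w) w \<inter> reads (m w) v) \<le> weight A * weight B"
proof -
  have "prob (\<Union>w\<in>A. \<Union>v\<in>B. reads (s w) w \<inter> reads (m w) v) \<le> (\<Sum>w\<in>A. prob (\<Union>v\<in>B. reads (s w) w \<inter> reads (m w) v))"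
    using A B by (intro finite_measure_subadditive_finite) auto
  also have "\<dots> \<le> (\<Sum>w\<in>A. \<Sum>v\<in>B. prob (reads (s w) w \<inter> reads (m w) v))"
    using B by (intro sum_mono finite_measure_subadditive_finite) auto
  also have "\<dots> = (\<Sum>w\<in>A. \<Sum>v\<in>B. step_prob TYPE('d) ^ length w * step_prob TYPE('d) ^ length v)"
    using A B sep by (intro sum.cong refl prob_reads_pair) auto
  finally show ?thesis by (simp add: weight_def sum_product)
qed

lemma walk_add: "walk X (n + j) \<omega> = walk X n \<omega> + (\<Sum>i<j. X (Suc (n + i)) \<omega>)"
  by (induction j) (simp_all add: walk_def)

lemma walk_reads:
  assumes "\<omega> \<in> reads n w" "j \<le> length w"
  shows "walk X (n + j) \<omega> = walk X n \<omega> + sum_list (take j w)"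
proof -
  have "(\<Sum>i<j. X (Suc (n + i)) \<omega>) = (\<Sum>i<j. w ! i)"
    using assms by (intro sum.cong) (auto simp: reads_def)
  also have "\<dots> = sum_list (take j w)"
    using assms(2) by (simp add: sum_list_sum_nth min_def atLeast0LessThan)
  finally show ?thesis by (simp add: walk_add)
qed

lemma proper_path:
  assumes "\<omega> \<in> proper" "n \<le> m"
  shows "\<exists>w\<in>words (m - n). \<omega> \<in> reads n w \<and> sum_list w = walk X m \<omega> - walk X n \<omega>"
proof -
  let ?w = "map (\<lambda>j. X (Suc (n + j)) \<omega>) [0..<m - n]"
  have "?w \<in> words (m - n)" using assms by (auto simp: words_def proper_def)
  moreover have rd: "\<omega> \<in> reads n ?w" using assms by (simp add: reads_def proper_def)
  moreover have "sum_list ?w = walk X m \<omega> - walk X n \<omega>"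
    using walk_reads[OF rd, of "m - n"] assms by simp
  ultimately show ?thesis by blast
qed

text \<open>Cutting a trajectory at its first return identifies the return event with the excursions.\<close>

lemma return_weight_limit: "return_weight TYPE('d) \<longlonglongrightarrow> 1 - escape_prob M X"
proof -
  let ?E = "\<lambda>L. starts 0 (excursions L {})"
  have return_eq: "return_weight TYPE('d) L = prob (?E L)" for L
    unfolding return_weight_def by (rule prob_starts[symmetric]) (simp, rule excursions_prefix_free, simp add: excursions_def)
  have lim: "(\<lambda>L. prob (?E L)) \<longlonglongrightarrow> prob (\<Union>L. ?E L)"
  proof (rule finite_Lim_measure_incseq)
    show "incseq ?E"
      unfolding incseq_def starts_def by (intro allI impI UN_mono excursions_mono order_refl)
    show "range ?E \<subseteq> events" by auto
  qed
  have walkm: "{\<omega> \<in> space M. \<forall>i\<ge>1. walk X i \<omega> \<noteq> 0} \<in> events"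
  proof -
    have "(\<lambda>\<omega>. walk X n \<omega>) \<in> M \<rightarrow>\<^sub>M count_space UNIV" for n
    proof (induction n)
      case (Suc n)
      have "walk X (Suc n) = (\<lambda>\<omega>. walk X n \<omega> + X (Suc n) \<omega>)" by (auto simp: walk_def)
      moreover have "(\<lambda>\<omega>. walk X n \<omega> + X (Suc n) \<omega>) \<in> M \<rightarrow>\<^sub>M count_space UNIV"
      proof (rule measurable_compose_countable'[where f = "\<lambda>a \<omega>. a + X (Suc n) \<omega>" and I = UNIV])
        fix a :: "int ^ 'd"
        show "(\<lambda>\<omega>. a + X (Suc n) \<omega>) \<in> M \<rightarrow>\<^sub>M count_space UNIV"
          by (rule measurable_compose[OF X_measurable]) auto
      qed (use Suc in auto)
      ultimately show ?case by simp
    qed (simp add: walk_def)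
    then have "range (\<lambda>i. walk X (Suc i) -` (- {0}) \<inter> space M) \<subseteq> events"
      by (auto intro!: measurable_sets)
    then have "(\<Inter>i. walk X (Suc i) -` (- {0}) \<inter> space M) \<in> events"
      by (rule sets.countable_INT) simp
    also have "(\<Inter>i. walk X (Suc i) -` (- {0}) \<inter> space M) = {\<omega> \<in> space M. \<forall>i\<ge>1. walk X i \<omega> \<noteq> 0}"
      by (auto simp: Suc_le_eq gr0_conv_Suc)
    finally show ?thesis .
  qed
  have "prob (\<Union>L. ?E L) = prob (space M - {\<omega> \<in> space M. \<forall>i\<ge>1. walk X i \<omega> \<noteq> 0})"
  proof (rule finite_measure_eq_AE)
    show "AE \<omega> in M. (\<omega> \<in> (\<Union>L. ?E L)) = (\<omega> \<in> space M - {\<omega> \<in> space M. \<forall>i\<ge>1. walk X i \<omega> \<noteq> 0})"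
      using AE_proper
    proof eventually_elim
      case (elim \<omega>)
      have sp: "\<omega> \<in> space M" using elim by (simp add: proper_def)
      have walk0: "walk X 0 \<omega> = 0" by (simp add: walk_def)
      show ?case
      proof
        assume "\<omega> \<in> (\<Union>L. ?E L)"
        then obtain L w where w: "w \<in> excursions L {}" "\<omega> \<in> reads 0 w" by (auto simp: starts_def)
        have "walk X (length w) \<omega> = 0"
          using walk_reads[OF w(2), of "length w"] w(1) walk0 by (simp add: excursions_def)
        moreover have "length w \<ge> 1" using w(1) by (cases w) (auto simp: excursions_def)
        ultimately show "\<omega> \<in> space M - {\<omega> \<in> space M. \<forall>i\<ge>1. walk X i \<omega> \<noteq> 0}" using sp by auto
      next
        assume "\<omega> \<in> space M - {\<omega> \<in> space M. \<forall>i\<ge>1. walk X i \<omega> \<noteq> 0}"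
        then have ex: "\<exists>i. i \<ge> 1 \<and> walk X i \<omega> = 0" by auto
        define l where "l = (LEAST i. i \<ge> 1 \<and> walk X i \<omega> = 0)"
        have l: "l \<ge> 1" "walk X l \<omega> = 0" using LeastI_ex[OF ex] by (auto simp: l_def)
        have least: "walk X i \<omega> \<noteq> 0" if "i \<ge> 1" "i < l" for i
          using not_less_Least[of i "\<lambda>i. i \<ge> 1 \<and> walk X i \<omega> = 0"] that by (auto simp: l_def)
        obtain w where w: "w \<in> words l" "\<omega> \<in> reads 0 w" "sum_list w = 0"
          using proper_path[OF elim, of 0 l] l walk0 by auto
        have "w \<in> excursions l {}"
          using w l least walk_reads[OF w(2)] walk0 by (auto simp: excursions_def words_def Suc_le_eq)
        then show "\<omega> \<in> (\<Union>L. ?E L)" using w by (auto simp: starts_def)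
      qed
    qed
    show "(\<Union>L. ?E L) \<in> events" by (intro sets.countable_UN) auto
    show "space M - {\<omega> \<in> space M. \<forall>i\<ge>1. walk X i \<omega> \<noteq> 0} \<in> events"
      by (rule sets.compl_sets[OF walkm])
  qed
  then have "prob (\<Union>L. ?E L) = 1 - escape_prob M X"
    unfolding escape_prob_def by (simp only: prob_compl[OF walkm])
  with lim have "(\<lambda>L. prob (?E L)) \<longlonglongrightarrow> 1 - escape_prob M X" by (simp only:)
  moreover have "return_weight TYPE('d) = (\<lambda>L. prob (?E L))" by (rule ext) (rule return_eq)
  ultimately show ?thesis by (simp only:)
qed

lemma starts_visits:
  assumes "\<omega> \<in> starts n (loops L V k)"
  shows "local_time X (walk X n \<omega>) \<omega> \<ge> ereal (real k)"
proof -
  obtain w where w: "w \<in> loops L V k" "\<omega> \<in> reads n w" using assms by (auto simp: starts_def)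
  let ?g = "\<lambda>j. n + j - 1"
  let ?f = "\<lambda>i. if walk X (Suc i) \<omega> = walk X n \<omega> then 1 else 0 :: ereal"
  have inj: "inj_on ?g (zeros w)" by (auto simp: inj_on_def zeros_def)
  have one: "?f (?g j) = 1" if "j \<in> zeros w" for j
    using that walk_reads[OF w(2), of j] by (auto simp: zeros_def)
  have "(\<Sum>j\<in>zeros w. 1 :: ereal) = ereal (\<Sum>j\<in>zeros w. 1)"
    by (simp only: sum_ereal one_ereal_def)
  then have "ereal (real k) = (\<Sum>j\<in>zeros w. 1)" using card_zeros_loops[OF w(1)] by simp
  also have "\<dots> = (\<Sum>j\<in>zeros w. ?f (?g j))" using one by (intro sum.cong) auto
  also have "\<dots> = (\<Sum>i\<in>?g ` zeros w. ?f i)" by (subst sum.reindex[OF inj]) (simp only: o_def)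
  also have "\<dots> \<le> local_time X (walk X n \<omega>) \<omega>"
    unfolding local_time_def by (intro sum_le_suminf) (auto intro: summable_ereal_pos)
  finally show ?thesis .
qed

lemma local_time_eq_0: "(\<And>j. j \<ge> 1 \<Longrightarrow> walk X j \<omega> \<noteq> y) \<Longrightarrow> local_time X y \<omega> = 0"
  by (simp add: local_time_def)

text \<open>The point \<open>S\<^sub>n + y\<close> is visited before time \<open>n\<close>, and an attempt from \<open>A\<close> succeeds at time \<open>n\<close>: the path
from the visit to time \<open>n\<close> has displacement \<open>- y\<close>.\<close>

definition hit_before :: "nat \<Rightarrow> int ^ 'd \<Rightarrow> (int ^ 'd) list set \<Rightarrow> 'a set" where
  "hit_before n y A = (\<Union>w\<in>paths_to {0<..n} (- y). \<Union>v\<in>A. reads (n - length w) w \<inter> reads n v)"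

text \<open>An attempt from \<open>A\<close> succeeds at time \<open>n\<close>, and \<open>S\<^sub>n + y\<close> is visited after its end. The words of \<open>A\<close>
will be closed, so the displacement from the end of the attempt is again \<open>y\<close>.\<close>

definition hit_after :: "nat \<Rightarrow> int ^ 'd \<Rightarrow> (int ^ 'd) list set \<Rightarrow> 'a set" where
  "hit_after n y A = (\<Union>N. \<Union>v\<in>A. \<Union>w\<in>paths_to {0<..N} y. reads n v \<inter> reads (n + length v) w)"

lemma paths_to_steps: "w \<in> paths_to I y \<Longrightarrow> set w \<subseteq> unit_steps"
  by (auto simp: paths_to_def words_def)

lemma hit_before_event: "finite A \<Longrightarrow> hit_before n y A \<in> events"
  unfolding hit_before_def by (intro sets.finite_UN sets.Int reads_event finite_paths_to) auto

lemma hit_after_event: "finite A \<Longrightarrow> hit_after n y A \<in> events"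
  unfolding hit_after_def by (intro sets.countable_UN' sets.finite_UN sets.Int reads_event finite_paths_to) auto

lemma prob_hit_before_le:
  assumes A: "finite A" "\<And>w. w \<in> A \<Longrightarrow> set w \<subseteq> unit_steps"
    and g: "\<And>N. (\<Sum>l\<in>{0<..N}. heat l (- y)) \<le> g"
  shows "prob (hit_before n y A) \<le> weight A * g"
proof -
  have "prob (hit_before n y A) \<le> weight (paths_to {0<..n} (- y)) * weight A"
    unfolding hit_before_def
  proof (rule prob_pairs_le)
    fix w :: "(int ^ 'd) list" assume "w \<in> paths_to {0<..n} (- y)"
    then show "set w \<subseteq> unit_steps" "n - length w + length w \<le> n"
      by (auto simp: paths_to_def words_def)
  qed (use A in auto)
  also have "\<dots> \<le> g * weight A"
    using g[of n] by (intro mult_right_mono weight_nonneg) (simp add: weight_paths_to)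
  finally show ?thesis by (simp add: mult.commute)
qed

lemma prob_hit_after_le:
  assumes A: "finite A" "\<And>w. w \<in> A \<Longrightarrow> set w \<subseteq> unit_steps"
    and g: "\<And>N. (\<Sum>l\<in>{0<..N}. heat l y) \<le> g"
  shows "prob (hit_after n y A) \<le> weight A * g"
proof -
  let ?H = "\<lambda>N. \<Union>v\<in>A. \<Union>w\<in>paths_to {0<..N} y. reads n v \<inter> reads (n + length v) w"
  have bound: "prob (?H N) \<le> weight A * g" for N
  proof -
    have "prob (?H N) \<le> weight A * weight (paths_to {0<..N} y)"
      by (rule prob_pairs_le) (use A in \<open>auto intro: paths_to_steps simp: subset_iff dest: paths_to_steps\<close>)
    also have "\<dots> \<le> weight A * g"
      using g[of N] by (intro mult_left_mono weight_nonneg) (simp add: weight_paths_to)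
    finally show ?thesis .
  qed
  have "(\<lambda>N. prob (?H N)) \<longlonglongrightarrow> prob (\<Union>N. ?H N)"
  proof (rule finite_Lim_measure_incseq)
    show "range ?H \<subseteq> events"
      using A by (auto intro!: sets.finite_UN)
    have "paths_to {0<..N} y \<subseteq> paths_to {0<..N'} y" if "N \<le> N'" for N N'
      using that unfolding paths_to_def by (intro UN_mono) auto
    then show "incseq ?H"
      unfolding incseq_def by (intro allI impI UN_mono order_refl) auto
  qed
  then have "prob (\<Union>N. ?H N) \<le> weight A * g"
    by (rule LIMSEQ_le_const2) (use bound in blast)
  then show ?thesis by (simp only: hit_after_def)
qed

text \<open>A visit happens before time \<open>n\<close>, during the attempt or after it; the attempt itself avoids the
point by the choice of the words.\<close>

lemma starts_unhit:
  assumes \<omega>: "\<omega> \<in> proper" "\<omega> \<in> starts n (loops L {y} k)"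
    and nb: "\<omega> \<notin> hit_before n y (loops L {y} k)" and na: "\<omega> \<notin> hit_after n y (loops L {y} k)"
    and y: "y \<noteq> 0"
  shows "local_time X (walk X n \<omega> + y) \<omega> = 0"
proof (rule local_time_eq_0)
  fix j :: nat
  obtain v where v: "v \<in> loops L {y} k" "\<omega> \<in> reads n v" using \<omega> by (auto simp: starts_def)
  show "walk X j \<omega> \<noteq> walk X n \<omega> + y"
  proof
    assume hit: "walk X j \<omega> = walk X n \<omega> + y"
    consider "j < n" | "n \<le> j" "j \<le> n + length v" | "n + length v < j" by linarith
    then show False
    proof cases
      case 1
      then obtain w where w: "w \<in> words (n - j)" "\<omega> \<in> reads j w" "sum_list w = walk X n \<omega> - walk X j \<omega>"
        using proper_path[OF \<omega>(1), of j n] by auto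
      have "length w = n - j" using w(1) by (simp add: words_def)
      then have "w \<in> paths_to {0<..n} (- y)" "n - length w = j"
        using w(1,3) hit 1 by (auto simp: paths_to_def)
      then show False using nb v w(2) unfolding hit_before_def by auto
    next
      case 2
      have "sum_list (take (j - n) v) = y"
        using walk_reads[OF v(2), of "j - n"] 2 hit by simp
      moreover have "j - n \<le> length v" using 2 by linarith
      ultimately show False using loops_avoid[OF _ v(1), of "j - n"] y by auto
    next
      case 3
      have "walk X (n + length v) \<omega> = walk X n \<omega>"
        using walk_reads[OF v(2), of "length v"] loops_sum[OF v(1)] by simp
      moreover obtain w where w: "w \<in> words (j - (n + length v))" "\<omega> \<in> reads (n + length v) w"
          "sum_list w = walk X j \<omega> - walk X (n + length v) \<omega>"
        using proper_path[OF \<omega>(1), of "n + length v" j] 3 by auto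
      ultimately have "w \<in> paths_to {0<..j} y"
        using hit 3 by (auto simp: paths_to_def words_def)
      then show False using na v w(2) unfolding hit_after_def by blast
    qed
  qed
qed

lemma prob_starts_loops: "prob (starts n (loops L V k)) = weight (loops L V k)"
  by (intro prob_starts loops_prefix_free loops_steps) auto

text \<open>Either the first attempt is completed before the second one starts, which gives the product of the
probabilities, or it is in progress at that time. In the second case only the excursions
completed so far are kept, without the avoidance, so that the bound is the same for all points to be avoided.\<close>

lemma prob_starts_pair_le:
  fixes V V' :: "(int ^ 'd) set"
  assumes nm: "n < m"
  shows "prob (starts n (loops L V k) \<inter> starts m (loops L' V' k'))
    \<le> weight (loops L V k) * weight (loops L' V' k')
      + (\<Sum>i<k. weight {w \<in> loops L ({} :: (int ^ 'd) set) i. length w \<le> m - n \<and> m - n < length w + L i}) * weight (loops L' V' k')"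
proof -
  let ?B = "loops L' V' k'"
  let ?A = "{w \<in> loops L V k. length w \<le> m - n}"
  let ?A' = "\<lambda>i. {w \<in> loops L ({} :: (int ^ 'd) set) i. length w \<le> m - n \<and> m - n < length w + L i}"
  let ?E = "\<lambda>A. \<Union>w\<in>A. \<Union>v\<in>?B. reads n w \<inter> reads m v"
  have sub: "starts n (loops L V k) \<inter> starts m ?B \<subseteq> ?E ?A \<union> (\<Union>i<k. ?E (?A' i))"
  proof
    fix \<omega> assume "\<omega> \<in> starts n (loops L V k) \<inter> starts m ?B"
    then obtain w v where w: "w \<in> loops L V k" "\<omega> \<in> reads n w" and v: "v \<in> ?B" "\<omega> \<in> reads m v"
      by (auto simp: starts_def)
    show "\<omega> \<in> ?E ?A \<union> (\<Union>i<k. ?E (?A' i))"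
    proof (cases "length w \<le> m - n")
      case True
      then show ?thesis using w v by blast
    next
      case False
      then obtain i u u' where i: "i < k" and u: "u \<in> loops L V i" "w = u @ u'"
          "length u \<le> m - n" "m - n < length u + L i"
        using loops_alive[OF w(1), of "m - n"] by auto
      have "u \<in> ?A' i" using u loops_anti_avoid[of L V i] by auto
      moreover have "\<omega> \<in> reads n u"
        using w(2) u(2) by (auto simp: reads_def nth_append)
      ultimately show ?thesis using i v by blast
    qed
  qed
  have E: "?E A \<in> events" if "finite A" for A
    using that by (intro sets.finite_UN sets.Int reads_event) auto
  have fin: "finite (?A' i)" for i by simp
  have "prob (starts n (loops L V k) \<inter> starts m ?B) \<le> prob (?E ?A \<union> (\<Union>i<k. ?E (?A' i)))"
    by (intro finite_measure_mono sub sets.Un sets.finite_UN E) auto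
  also have "\<dots> \<le> prob (?E ?A) + prob (\<Union>i<k. ?E (?A' i))"
    by (intro measure_Un_le sets.finite_UN E) auto
  also have "prob (\<Union>i<k. ?E (?A' i)) \<le> (\<Sum>i<k. prob (?E (?A' i)))"
    by (intro finite_measure_subadditive_finite image_subsetI E) auto
  also have "\<dots> \<le> (\<Sum>i<k. weight (?A' i) * weight ?B)"
    by (intro sum_mono prob_pairs_le) (use nm in \<open>auto dest: loops_steps\<close>)
  also have "prob (?E ?A) \<le> weight ?A * weight ?B"
    by (intro prob_pairs_le) (use nm in \<open>auto dest: loops_steps\<close>)
  also have "weight ?A * weight ?B \<le> weight (loops L V k) * weight ?B"
    by (intro mult_right_mono weight_mono weight_nonneg) auto
  finally show ?thesis by (simp add: sum_distrib_right)
qed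

end

section \<open>Elementary estimates\<close>

lemma sum_inverse_squares_le: "(\<Sum>i<k. 1 / (real (i + 1))\<^sup>2) \<le> 2"
proof -
  have "(\<Sum>i<k. 1 / (real (i + 1))\<^sup>2) \<le> 2 - 1 / real k" if "k > 0" for k
    using that
  proof (induction k)
    case (Suc k)
    show ?case
    proof (cases "k = 0")
      case False
      have "1 / (real (k + 1))\<^sup>2 \<le> 1 / (real k * real (k + 1))"
        using False by (intro divide_left_mono) (auto simp: power2_eq_square)
      also have "\<dots> = 1 / real k - 1 / real (Suc k)" using False by (simp add: field_simps)
      finally show ?thesis using Suc.IH False by simp
    qed simp
  qed simp
  from this[of k] have "k > 0 \<Longrightarrow> (\<Sum>i<k. 1 / (real (i + 1))\<^sup>2) \<le> 2"
    by (rule order_trans) auto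
  then show ?thesis by (cases "k = 0") auto
qed

lemma exp_le_one_minus: "0 \<le> t \<Longrightarrow> t \<le> 1 / 2 \<Longrightarrow> exp (- (2 * t)) \<le> 1 - (t::real)"
proof -
  assume t: "0 \<le> t" "t \<le> 1 / 2"
  have "t * t \<le> t * (1 / 2)" using t by (intro mult_left_mono) auto
  then have "- (2 * t) \<le> - t - 2 * t\<^sup>2" by (simp add: power2_eq_square)
  also have "\<dots> \<le> ln (1 - t)" using ln_one_minus_pos_lower_bound[OF t] by simp
  finally have "exp (- (2 * t)) \<le> exp (ln (1 - t))" by simp
  then show ?thesis using t by simp
qed

text \<open>Comparison with the increments of \<open>ln (ln n)\<close>.\<close>

lemma sum_inverse_ln_unbounded:
  assumes "N \<ge> 3"
  shows "\<exists>N'\<ge>N. s \<le> (\<Sum>n\<in>{N..<N'}. 1 / (real n * ln (real n)))"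
proof -
  have ln1: "ln (real n) > 0" if "n \<ge> 3" for n using that by simp
  have incr: "ln (ln (real (Suc n))) - ln (ln (real n)) \<le> 1 / (real n * ln (real n))" if n: "n \<ge> 3" for n
  proof -
    have "ln (real (Suc n)) - ln (real n) = ln (real (Suc n) / real n)" using n by (simp add: ln_div)
    also have "\<dots> \<le> real (Suc n) / real n - 1" using n by (intro ln_le_minus_one) simp
    also have "\<dots> = 1 / real n" using n by (simp add: field_simps)
    finally have 1: "ln (real (Suc n)) - ln (real n) \<le> 1 / real n" .
    have "ln (ln (real (Suc n))) - ln (ln (real n)) = ln (ln (real (Suc n)) / ln (real n))"
      using ln1[of n] ln1[of "Suc n"] n by (simp add: ln_div)
    also have "\<dots> \<le> ln (real (Suc n)) / ln (real n) - 1"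
      using ln1[of n] ln1[of "Suc n"] n by (intro ln_le_minus_one divide_pos_pos) auto
    also have "\<dots> = (ln (real (Suc n)) - ln (real n)) / ln (real n)"
      using ln1[OF n] by (simp add: diff_divide_distrib)
    also have "\<dots> \<le> (1 / real n) / ln (real n)"
      using ln1[OF n] 1 by (intro divide_right_mono) auto
    finally show ?thesis by simp
  qed
  have tele: "ln (ln (real N')) - ln (ln (real N)) \<le> (\<Sum>n\<in>{N..<N'}. 1 / (real n * ln (real n)))" if "N \<le> N'" for N'
    using that
  proof (induction N' rule: dec_induct)
    case (step n)
    then show ?case using assms incr[of n] by simp
  qed simp
  have "filterlim (\<lambda>n. ln (ln (real n))) at_top sequentially"
    by (intro filterlim_compose[OF ln_at_top] filterlim_real_sequentially)
  then have "eventually (\<lambda>n. s + ln (ln (real N)) \<le> ln (ln (real n))) sequentially"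
    by (simp add: filterlim_at_top)
  then have "eventually (\<lambda>n. N \<le> n \<and> s + ln (ln (real N)) \<le> ln (ln (real n))) sequentially"
    using eventually_ge_at_top[of N] by eventually_elim auto
  then obtain N' where "N' \<ge> N" "s + ln (ln (real N)) \<le> ln (ln (real N'))"
    by (auto simp: eventually_sequentially)
  then show ?thesis using tele[of N'] by (intro exI[of _ N']) auto
qed

lemma summable_geometric_poly:
  fixes q :: real
  assumes q: "0 < q" "q < 1"
  shows "summable (\<lambda>i. q ^ i * real (K * (i + 1) ^ 4))"
proof -
  have "(\<lambda>n. q * ((real n + 2) / (real n + 1)) ^ 4) \<longlonglongrightarrow> q * 1 ^ 4"
  proof (intro tendsto_intros)
    have "(\<lambda>n. 1 + 1 / (real n + 1)) \<longlonglongrightarrow> 1 + 0"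
      by (intro tendsto_intros) (use LIMSEQ_Suc[OF lim_1_over_n] in \<open>simp add: add.commute\<close>)
    moreover have "1 + 1 / (real n + 1) = (real n + 2) / (real n + 1)" for n by (simp add: field_simps)
    ultimately show "(\<lambda>n. (real n + 2) / (real n + 1)) \<longlonglongrightarrow> 1" by simp
  qed
  then have "eventually (\<lambda>n. q * ((real n + 2) / (real n + 1)) ^ 4 < (1 + q) / 2) sequentially"
    using q by (intro order_tendstoD(2)) auto
  then obtain N where N: "\<And>n. n \<ge> N \<Longrightarrow> q * ((real n + 2) / (real n + 1)) ^ 4 < (1 + q) / 2"
    by (auto simp: eventually_sequentially)
  have "summable (\<lambda>i. q ^ i * (real i + 1) ^ 4)"
  proof (rule summable_ratio_test)
    show "(1 + q) / 2 < 1" using q by simp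
    fix n assume n: "n \<ge> N"
    have "q ^ Suc n * (real (Suc n) + 1) ^ 4 = (q * ((real n + 2) / (real n + 1)) ^ 4) * (q ^ n * (real n + 1) ^ 4)"
      by (simp add: power_divide add.commute)
    also have "\<dots> \<le> ((1 + q) / 2) * (q ^ n * (real n + 1) ^ 4)"
      using N[OF n] q by (intro mult_right_mono) auto
    finally show "norm (q ^ Suc n * (real (Suc n) + 1) ^ 4) \<le> (1 + q) / 2 * norm (q ^ n * (real n + 1) ^ 4)"
      using q by simp
  qed
  then have "summable (\<lambda>i. real K * (q ^ i * (real i + 1) ^ 4))" by (rule summable_mult)
  then show ?thesis by (simp add: mult_ac add.commute)
qed

section \<open>Probability of a successful attempt and correlations\<close>

context lattice_walk
begin

text \<open>The return probability.\<close>

definition q :: real where "q = 1 - escape_prob M X"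

lemma return_weight_tendsto_q: "return_weight TYPE('d) \<longlonglongrightarrow> q"
  unfolding q_def by (rule return_weight_limit)

lemma return_weight_le_q: "return_weight TYPE('d) L \<le> q"
  by (rule incseq_le[OF _ return_weight_tendsto_q]) (auto simp: incseq_def intro: return_weight_mono)

lemma q_less_1: "CARD('d) \<ge> 3 \<Longrightarrow> q < 1"
  by (rule return_weight_limit_less_1[OF _ return_weight_tendsto_q])

lemma q_pos: "q > 0"
proof -
  obtain i :: 'd where True by simp
  let ?w = "[axis i 1, - axis i 1] :: (int ^ 'd) list"
  have ne: "axis i (1::int) \<noteq> 0" by (simp add: axis_eq_0_iff)
  have w: "?w \<in> excursions 2 {}"
    using ne by (auto simp: excursions_def unit_steps_def less_Suc_eq numeral_2_eq_2)
  have "0 < step_prob TYPE('d) ^ length ?w" using step_prob_pos by (intro zero_less_power)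
  also have "\<dots> = weight {?w}" by (simp add: weight_def)
  also have "\<dots> \<le> return_weight TYPE('d) 2" unfolding return_weight_def using w by (intro weight_mono) auto
  also have "\<dots> \<le> q" by (rule return_weight_le_q)
  finally show ?thesis .
qed

lemma lam_q: "lam M X = - 1 / ln q"
  by (simp add: lam_def q_def)

text \<open>From all returning trajectories those with a late first return and those through \<open>x\<close> are removed.\<close>

lemma excursion_weight_ge:
  fixes x :: "int ^ 'd"
  assumes d: "CARD('d) \<ge> 3" and L: "L \<ge> 1" and x: "x \<noteq> 0"
    and g: "\<And>N. (\<Sum>l\<in>{0<..N}. heat l x) \<le> g" "\<And>N. (\<Sum>l\<in>{0<..N}. heat l (- x)) \<le> g"
  shows "weight (excursions L {x}) \<ge> q - 2 * heat_const TYPE('d) / sqrt (real L) - g\<^sup>2"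
proof -
  have "return_weight TYPE('d) L' \<le> return_weight TYPE('d) L + 2 * heat_const TYPE('d) / sqrt (real L)" for L'
    using return_weight_le_tail[where 'd = 'd, of L' L] return_tail[OF d L, of 0 L'] by linarith
  then have "q \<le> return_weight TYPE('d) L + 2 * heat_const TYPE('d) / sqrt (real L)"
    by (intro LIMSEQ_le_const2[OF return_weight_tendsto_q]) blast
  moreover have "(\<Sum>l\<in>{0<..L}. heat l x) * (\<Sum>l\<in>{0<..L}. heat l (- x)) \<le> g * g"
    by (intro mult_mono g sum_nonneg heat_nonneg order_trans[OF _ g(1)[of L]])
  ultimately show ?thesis
    using return_weight_le_avoid[OF x, of L] by (simp add: power2_eq_square)
qed

text \<open>Truncating the excursions costs a convergent product, and avoiding \<open>x\<close> costs a factor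
\<open>exp (- O(k * g\<^sup>2))\<close>, where \<open>g\<close> bounds the Green function. The factor is bounded below as long as
\<open>k * g\<^sup>2\<close> is bounded.\<close>

lemma loops_weight_ge:
  assumes d: "CARD('d) \<ge> 3"
  obtains K where "\<And>(x :: int ^ 'd) g k. x \<noteq> 0 \<Longrightarrow> (\<And>N. (\<Sum>l\<in>{0<..N}. heat l x) \<le> g) \<Longrightarrow>
      (\<And>N. (\<Sum>l\<in>{0<..N}. heat l (- x)) \<le> g) \<Longrightarrow> g\<^sup>2 \<le> q / 4 \<Longrightarrow>
      q ^ k * exp (- (1 + 2 * real k * g\<^sup>2 / q)) \<le> weight (loops (\<lambda>i. K * (i + 1) ^ 4) {x} k)"
proof -
  let ?H = "heat_const TYPE('d)"
  have H: "?H > 0" using heat_const_ge[where 'd = 'd] by linarith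
  \<comment> \<open>This \<open>K\<close> makes the truncation error of excursion \<open>i\<close> at most \<open>q / (4 * (i + 1)\<^sup>2)\<close>.\<close>
  obtain K :: nat where K: "(8 * ?H / q)\<^sup>2 \<le> real K" using real_arch_simple by blast
  have pos: "8 * ?H / q > 0" using H q_pos by simp
  have sK: "8 * ?H / q \<le> sqrt (real K)" using K by (rule real_le_rsqrt)
  then have K0: "sqrt (real K) > 0" using pos by linarith
  then have K1: "K \<ge> 1" by simp
  have trunc: "2 * ?H / sqrt (real K) \<le> q / 4"
    using sK K0 q_pos by (simp add: field_simps)
  show thesis
  proof (rule that)
    fix x :: "int ^ 'd" and g :: real and k :: nat
    assume x: "x \<noteq> 0" and g1: "\<And>N. (\<Sum>l\<in>{0<..N}. heat l x) \<le> g"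
      and g2: "\<And>N. (\<Sum>l\<in>{0<..N}. heat l (- x)) \<le> g" and gq: "g\<^sup>2 \<le> q / 4"
    define t where "t i = 1 / (4 * (real (i + 1))\<^sup>2) + g\<^sup>2 / q" for i
    have t0: "t i \<ge> 0" for i using q_pos by (simp add: t_def)
    have t1: "t i \<le> 1 / 2" for i
    proof -
      have "1 * 1 \<le> real (i + 1) * real (i + 1)" by (intro mult_mono) auto
      then have "1 / (4 * (real (i + 1))\<^sup>2) \<le> 1 / (4 * 1)"
        by (intro divide_left_mono) (auto simp: power2_eq_square)
      then have "1 / (4 * (real (i + 1))\<^sup>2) \<le> 1 / 4" by (simp only: mult_1_right)
      moreover have "g\<^sup>2 / q \<le> 1 / 4" using gq q_pos by (simp add: field_simps)
      moreover have "1 / 4 + 1 / 4 = (1 / 2 :: real)" by simp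
      ultimately show ?thesis unfolding t_def by (metis add_mono)
    qed
    have factor: "q * exp (- (2 * t i)) \<le> weight (excursions (K * (i + 1) ^ 4) {x})" for i
    proof -
      have L: "K * (i + 1) ^ 4 \<ge> 1" using K1 by simp
      have "sqrt (real (K * (i + 1) ^ 4)) = sqrt (real K) * (real (i + 1))\<^sup>2"
      proof -
        have "sqrt ((real (i + 1)) ^ 4) = (real (i + 1))\<^sup>2"
          by (rule real_sqrt_unique) (auto simp flip: power_mult)
        then show ?thesis by (simp add: real_sqrt_mult)
      qed
      then have "2 * ?H / sqrt (real (K * (i + 1) ^ 4)) = (2 * ?H / sqrt (real K)) / (real (i + 1))\<^sup>2"
        by simp
      also have "\<dots> \<le> (q / 4) / (real (i + 1))\<^sup>2" using trunc by (intro divide_right_mono) auto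
      finally have "q - (q / 4) / (real (i + 1))\<^sup>2 - g\<^sup>2 \<le> weight (excursions (K * (i + 1) ^ 4) {x})"
        using excursion_weight_ge[OF d L x g1 g2] by linarith
      moreover have "q * (1 - t i) = q - (q / 4) / (real (i + 1))\<^sup>2 - g\<^sup>2"
        using q_pos by (simp add: t_def right_diff_distrib distrib_left)
      moreover have "q * exp (- (2 * t i)) \<le> q * (1 - t i)"
        using q_pos by (intro mult_left_mono exp_le_one_minus t0 t1) auto
      ultimately show ?thesis by linarith
    qed
    have "(\<Sum>i<k. 2 * t i) = (1 / 2) * (\<Sum>i<k. 1 / (real (i + 1))\<^sup>2) + 2 * real k * g\<^sup>2 / q"
      by (simp add: t_def distrib_left sum.distrib sum_distrib_left)
    then have "(\<Sum>i<k. 2 * t i) \<le> 1 + 2 * real k * g\<^sup>2 / q"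
      using sum_inverse_squares_le[of k] by linarith
    then have "q ^ k * exp (- (1 + 2 * real k * g\<^sup>2 / q)) \<le> q ^ k * exp (\<Sum>i<k. - (2 * t i))"
      using q_pos by (intro mult_left_mono) (auto simp: sum_negf)
    also have "\<dots> = (\<Prod>i<k. q * exp (- (2 * t i)))"
      by (simp add: exp_sum prod.distrib)
    also have "\<dots> \<le> (\<Prod>i<k. weight (excursions (K * (i + 1) ^ 4) {x}))"
      using q_pos by (intro prod_mono conjI factor) auto
    also have "\<dots> = weight (loops (\<lambda>i. K * (i + 1) ^ 4) {x} k)"
      by (rule weight_loops[symmetric])
    finally show "q ^ k * exp (- (1 + 2 * real k * g\<^sup>2 / q)) \<le> weight (loops (\<lambda>i. K * (i + 1) ^ 4) {x} k)" .
  qed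
qed

text \<open>An undecided attempt with \<open>i\<close> completed excursions has probability at most \<open>q ^ i\<close> and lasts at most
\<open>L i\<close> further steps until it is decided or the next excursion is completed. The sum over \<open>n\<close> is therefore bounded
uniformly in \<open>m\<close>.\<close>

lemma starts_correlation:
  fixes x :: "nat \<Rightarrow> int ^ 'd" and L k :: "nat \<Rightarrow> nat"
  assumes sum: "summable (\<lambda>i. q ^ i * real (L i))"
  defines "B \<equiv> \<lambda>n. starts n (loops L {x n} (k n))"
  shows "(\<Sum>n\<in>{N..<m}. prob (B n \<inter> B m) - prob (B n) * prob (B m)) \<le> (\<Sum>i. q ^ i * real (L i)) * prob (B m)"
proof -
  let ?w = "\<lambda>i l. weight {w \<in> loops L ({} :: (int ^ 'd) set) i. length w \<le> l \<and> l < length w + L i}"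
  have pm: "prob (B n) = weight (loops L {x n} (k n))" for n
    unfolding B_def by (rule prob_starts_loops)
  define kk where "kk = (\<Sum>n\<in>{N..<m}. k n)"
  have "(\<Sum>n\<in>{N..<m}. prob (B n \<inter> B m) - prob (B n) * prob (B m)) \<le> (\<Sum>n\<in>{N..<m}. (\<Sum>i<kk. ?w i (m - n)) * prob (B m))"
  proof (rule sum_mono)
    fix n assume n: "n \<in> {N..<m}"
    have "k n \<le> kk" unfolding kk_def using n by (intro member_le_sum) auto
    then have "(\<Sum>i<k n. ?w i (m - n)) \<le> (\<Sum>i<kk. ?w i (m - n))"
      by (intro sum_mono2 weight_nonneg) auto
    then have "(\<Sum>i<k n. ?w i (m - n)) * prob (B m) \<le> (\<Sum>i<kk. ?w i (m - n)) * prob (B m)"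
      by (intro mult_right_mono) auto
    moreover have "prob (B n \<inter> B m) \<le> prob (B n) * prob (B m) + (\<Sum>i<k n. ?w i (m - n)) * prob (B m)"
      unfolding pm unfolding B_def using n by (intro prob_starts_pair_le) auto
    ultimately show "prob (B n \<inter> B m) - prob (B n) * prob (B m) \<le> (\<Sum>i<kk. ?w i (m - n)) * prob (B m)"
      by linarith
  qed
  also have "\<dots> = (\<Sum>i<kk. \<Sum>n\<in>{N..<m}. ?w i (m - n)) * prob (B m)"
    unfolding sum_distrib_right[symmetric] by (subst sum.swap) (rule refl)
  also have "\<dots> \<le> (\<Sum>i<kk. q ^ i * real (L i)) * prob (B m)"
  proof (intro mult_right_mono sum_mono)
    fix i
    have "(\<Sum>n\<in>{N..<m}. ?w i (m - n)) = (\<Sum>l\<in>(\<lambda>n. m - n) ` {N..<m}. ?w i l)"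
      by (subst sum.reindex) (auto simp: inj_on_def)
    also have "\<dots> \<le> (\<Sum>l<Suc m. ?w i l)"
      by (intro sum_mono2 weight_nonneg) auto
    also have "\<dots> \<le> weight (loops L ({} :: (int ^ 'd) set) i) * real (L i)"
      by (rule sum_alive_le)
    also have "weight (loops L ({} :: (int ^ 'd) set) i) = (\<Prod>j<i. return_weight TYPE('d) (L j))"
      by (simp add: weight_loops return_weight_def)
    also have "\<dots> \<le> (\<Prod>j<i. q)"
      by (intro prod_mono conjI return_weight_nonneg return_weight_le_q)
    finally show "(\<Sum>n\<in>{N..<m}. ?w i (m - n)) \<le> q ^ i * real (L i)"
      by (simp add: mult_right_mono)
  qed auto
  also have "\<dots> \<le> (\<Sum>i. q ^ i * real (L i)) * prob (B m)"
    using q_pos by (intro mult_right_mono sum_le_suminf sum) auto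
  finally show ?thesis .
qed

section \<open>Heavy points near unvisited points\<close>

text \<open>The exponent \<open>1 / (2 * d - 4)\<close> is the one for which \<open>\<rho> ^ (d - 2)\<close> is the square root of
\<open>t\<close>, so the square of the Green function is of order \<open>1 / t\<close>.\<close>

lemma green_at_distance_le:
  fixes x :: "int ^ 'd"
  assumes d: "CARD('d) \<ge> 3" and c: "c > 0" and t: "t > 0"
    and x: "c * t powr (1 / (2 * real CARD('d) - 4)) \<le> lattice_norm x"
  shows "(\<Sum>l\<in>{0<..N}. heat l x) \<le> (green_const TYPE('d) * real CARD('d) ^ (CARD('d) - 2) / c ^ (CARD('d) - 2)) / sqrt t"
proof -
  let ?\<rho> = "c * t powr (1 / (2 * real CARD('d) - 4))"
  have "(t powr (1 / (2 * real CARD('d) - 4))) ^ (CARD('d) - 2)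
      = t powr ((1 / (2 * real CARD('d) - 4)) * real (CARD('d) - 2))"
    using t by (subst powr_power) auto
  also have "(1 / (2 * real CARD('d) - 4)) * real (CARD('d) - 2) = 1 / 2"
    using d by (simp add: of_nat_diff field_simps)
  also have "t powr (1 / 2) = sqrt t" using t by (simp add: powr_half_sqrt)
  finally have "?\<rho> ^ (CARD('d) - 2) = c ^ (CARD('d) - 2) * sqrt t" by (simp add: power_mult_distrib)
  then show ?thesis using green_le[OF d x, of N] c t by simp
qed

text \<open>By the choice of \<open>\<lambda>\<close>, \<open>q\<close> to the power of the level is \<open>1 / (n * ln n)\<close>; rounding up
costs at most one factor \<open>q\<close>.\<close>

lemma level_bounds:
  assumes q1: "q < 1" and n: "ln (real n) \<ge> 1"
  defines "k \<equiv> nat \<lceil>lam M X * (ln (real n) + ln (ln (real n)))\<rceil>"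
  shows "lam M X * (ln (real n) + ln (ln (real n))) \<le> real k"
    and "real k \<le> (2 * lam M X + 1) * ln (real n)"
    and "q / (real n * ln (real n)) \<le> q ^ k"
proof -
  let ?s = "ln (real n) + ln (ln (real n))"
  have lnq: "ln q < 0" using q_pos q1 by simp
  have lam: "lam M X > 0" using lnq by (simp add: lam_q divide_neg_neg)
  have lnln: "0 \<le> ln (ln (real n))" "ln (ln (real n)) \<le> ln (real n)"
    using n ln_le_minus_one[of "ln (real n)"] by auto
  have n0: "real n > 0" using n by (cases "n = 0") auto
  have s: "lam M X * ?s \<ge> 0" using lam lnln n by (intro mult_nonneg_nonneg) auto
  show lower: "lam M X * ?s \<le> real k"
    unfolding k_def by (rule real_nat_ceiling_ge)
  have upper: "real k \<le> lam M X * ?s + 1"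
    using s unfolding k_def by linarith
  also have "\<dots> \<le> lam M X * (2 * ln (real n)) + ln (real n)"
    using lam lnln n by (intro add_mono mult_left_mono) auto
  finally show "real k \<le> (2 * lam M X + 1) * ln (real n)" by (simp add: algebra_simps)
  have "ln q * (lam M X * ?s + 1) \<le> ln q * real k"
    using upper lnq by (intro mult_left_mono_neg) auto
  moreover have "ln q * (lam M X * ?s + 1) = ln q - ?s"
    using lnq by (simp add: lam_q field_simps)
  ultimately have "exp (ln q - ?s) \<le> exp (ln q * real k)" by simp
  also have "\<dots> = q ^ k" using q_pos by (simp add: exp_of_nat2_mult)
  also have "exp (ln q - ?s) = q / (real n * ln (real n))"
  proof -
    have "exp (ln (ln (real n))) = ln (real n)" using n by (intro exp_ln) linarith
    then show ?thesis using q_pos n0 by (simp add: exp_diff exp_add del: exp_ln_iff)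
  qed
  finally show "q / (real n * ln (real n)) \<le> q ^ k" .
qed

text \<open>The number of excursions is of order \<open>ln n\<close> and the square of the Green function at \<open>x n\<close> of order
\<open>1 / ln n\<close>, so an attempt at time \<open>n\<close> succeeds with probability at least a constant times
\<open>1 / (n * ln n)\<close>. The sum of these diverges.\<close>

lemma heavy_point_near_unvisited_point:
  fixes x :: "nat \<Rightarrow> int ^ 'd"
  assumes d: "CARD('d) \<ge> 3" and c: "c > 0"
    and x: "eventually (\<lambda>n. c * ln (real n) powr (1 / (2 * real CARD('d) - 4)) \<le> lattice_norm (x n)) sequentially"
  shows "AE \<omega> in M. \<exists>\<^sub>\<infinity>n. ereal (lam M X * (ln (real n) + ln (ln (real n)))) \<le> local_time X (walk X n \<omega>) \<omega>
      \<and> local_time X (walk X n \<omega> + x n) \<omega> = 0"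
proof -
  obtain K where K: "\<And>(y :: int ^ 'd) g k. y \<noteq> 0 \<Longrightarrow> (\<And>N. (\<Sum>l\<in>{0<..N}. heat l y) \<le> g) \<Longrightarrow>
      (\<And>N. (\<Sum>l\<in>{0<..N}. heat l (- y)) \<le> g) \<Longrightarrow> g\<^sup>2 \<le> q / 4 \<Longrightarrow>
      q ^ k * exp (- (1 + 2 * real k * g\<^sup>2 / q)) \<le> weight (loops (\<lambda>i. K * (i + 1) ^ 4) {y} k)"
    using loops_weight_ge[OF d] by metis
  have q1: "q < 1" by (rule q_less_1[OF d])
  define L where "L = (\<lambda>i::nat. K * (i + 1) ^ 4)"
  define k where "k = (\<lambda>n. nat \<lceil>lam M X * (ln (real n) + ln (ln (real n)))\<rceil>)"
  define G where "G = green_const TYPE('d) * real CARD('d) ^ (CARD('d) - 2) / c ^ (CARD('d) - 2)"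
  define g where "g = (\<lambda>n. G / sqrt (ln (real n)))"
  define A where "A = (\<lambda>n. loops L {x n} (k n))"
  define B where "B = (\<lambda>n. starts n (A n))"
  define D where "D = (\<lambda>n. hit_before n (x n) (A n) \<union> hit_after n (x n) (A n))"
  have A_steps: "set w \<subseteq> unit_steps" if "w \<in> A n" for w n
    using that loops_steps unfolding A_def by blast
  have A_fin: "finite (A n)" for n by (simp add: A_def)
  have prob_B: "prob (B n) = weight (A n)" for n
    unfolding B_def A_def by (rule prob_starts_loops)
  have g0: "g \<longlonglongrightarrow> 0"
    unfolding g_def
    by (intro tendsto_divide_0[OF tendsto_const] filterlim_at_top_imp_at_infinity
        filterlim_compose[OF sqrt_at_top] filterlim_compose[OF ln_at_top] filterlim_real_sequentially)
  have ln_large: "eventually (\<lambda>n. b \<le> ln (real n)) sequentially" for b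
    using filterlim_compose[OF ln_at_top filterlim_real_sequentially] by (simp add: filterlim_at_top)
  have far: "eventually (\<lambda>n. x n \<noteq> 0 \<and> (\<forall>N. (\<Sum>l\<in>{0<..N}. heat l (x n)) \<le> g n)
      \<and> (\<forall>N. (\<Sum>l\<in>{0<..N}. heat l (- x n)) \<le> g n)) sequentially"
    using x ln_large[of 1]
  proof eventually_elim
    case (elim n)
    then have t: "ln (real n) > 0" by linarith
    have "0 < c * ln (real n) powr (1 / (2 * real CARD('d) - 4))" using c t by simp
    then have "lattice_norm (x n) > 0" using elim by linarith
    then have "x n \<noteq> 0" by (auto simp: lattice_norm_def zero_vec_def[symmetric])
    moreover have "(\<Sum>l\<in>{0<..N}. heat l (x n)) \<le> g n" for N
      unfolding g_def G_def by (rule green_at_distance_le[OF d c t elim(1)])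
    moreover have "(\<Sum>l\<in>{0<..N}. heat l (- x n)) \<le> g n" for N
      unfolding g_def G_def by (rule green_at_distance_le[OF d c t]) (use elim in \<open>simp add: lattice_norm_minus\<close>)
    ultimately show ?case by blast
  qed
  define E where "E = 1 + 2 * (2 * lam M X + 1) * G\<^sup>2 / q"
  have heavy_weight: "eventually (\<lambda>n. q * exp (- E) * (1 / (real n * ln (real n))) \<le> weight (A n)) sequentially"
    using far ln_large[of 1] ln_large[of "4 * G\<^sup>2 / q"]
  proof eventually_elim
    case (elim n)
    have t: "ln (real n) > 0" using elim by linarith
    have g2: "(g n)\<^sup>2 = G\<^sup>2 / ln (real n)" using t by (simp add: g_def power_divide)
    have "4 * G\<^sup>2 \<le> ln (real n) * q" using elim(3) q_pos by (simp add: divide_le_eq)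
    then have small: "(g n)\<^sup>2 \<le> q / 4" unfolding g2 using t by (simp add: divide_le_eq mult.commute)
    have "q ^ k n * exp (- (1 + 2 * real (k n) * (g n)\<^sup>2 / q)) \<le> weight (A n)"
      unfolding A_def L_def using elim(1) small by (intro K) auto
    moreover have "q / (real n * ln (real n)) * exp (- E) \<le> q ^ k n * exp (- (1 + 2 * real (k n) * (g n)\<^sup>2 / q))"
    proof (intro mult_mono)
      show "q / (real n * ln (real n)) \<le> q ^ k n"
        unfolding k_def by (rule level_bounds(3)[OF q1 elim(2)])
      have "real (k n) * (g n)\<^sup>2 \<le> ((2 * lam M X + 1) * ln (real n)) * (g n)\<^sup>2"
        unfolding k_def by (intro mult_right_mono level_bounds(2)[OF q1 elim(2)]) auto
      also have "\<dots> = (2 * lam M X + 1) * G\<^sup>2" using t by (simp add: g2)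
      finally have "2 * (real (k n) * (g n)\<^sup>2) / q \<le> 2 * ((2 * lam M X + 1) * G\<^sup>2) / q"
        using q_pos by (intro divide_right_mono) auto
      then show "exp (- E) \<le> exp (- (1 + 2 * real (k n) * (g n)\<^sup>2 / q))"
        by (simp only: E_def mult.assoc exp_le_cancel_iff neg_le_iff_le add_le_cancel_left)
    qed (use q_pos in auto)
    ultimately show ?case by (simp add: mult_ac)
  qed
  have div: "\<exists>N'. s \<le> (\<Sum>n\<in>{N..<N'}. weight (A n))" for N s
  proof -
    obtain N1 where N1: "\<And>n. n \<ge> N1 \<Longrightarrow> q * exp (- E) * (1 / (real n * ln (real n))) \<le> weight (A n)"
      using heavy_weight by (auto simp: eventually_sequentially)
    let ?N = "max (max N N1) 3"
    obtain N' where N': "s / (q * exp (- E)) \<le> (\<Sum>n\<in>{?N..<N'}. 1 / (real n * ln (real n)))"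
      using sum_inverse_ln_unbounded[of ?N] by auto
    have "s \<le> q * exp (- E) * (\<Sum>n\<in>{?N..<N'}. 1 / (real n * ln (real n)))"
      using N' q_pos by (simp add: divide_le_eq mult.commute)
    also have "\<dots> \<le> (\<Sum>n\<in>{?N..<N'}. weight (A n))"
      unfolding sum_distrib_left by (intro sum_mono N1) auto
    also have "\<dots> \<le> (\<Sum>n\<in>{N..<N'}. weight (A n))"
      by (intro sum_mono2 weight_nonneg) auto
    finally show ?thesis by blast
  qed
  have bad: "eventually (\<lambda>n. prob (D n) \<le> weight (A n) * (2 * g n)) sequentially"
    using far
  proof eventually_elim
    case (elim n)
    have "prob (D n) \<le> prob (hit_before n (x n) (A n)) + prob (hit_after n (x n) (A n))"
      unfolding D_def by (intro measure_Un_le hit_before_event hit_after_event A_fin)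
    also have "\<dots> \<le> weight (A n) * g n + weight (A n) * g n"
      using elim by (intro add_mono prob_hit_before_le prob_hit_after_le A_fin A_steps) auto
    also have "\<dots> = weight (A n) * (2 * g n)" by simp
    finally show ?case .
  qed
  have summ: "summable (\<lambda>i. q ^ i * real (L i))"
    unfolding L_def by (rule summable_geometric_poly[OF q_pos q1])
  have "AE \<omega> in M. \<exists>\<^sub>\<infinity>n. \<omega> \<in> B n - D n"
  proof (rule infinitely_often_second_moment)
    show "B n \<in> events" for n unfolding B_def by (intro starts_event A_fin)
    show "D n \<in> events" for n
      unfolding D_def by (intro sets.Un hit_before_event hit_after_event A_fin)
    show "(\<Sum>n\<in>{N..<m}. prob (B n \<inter> B m) - weight (A n) * weight (A m)) \<le> (\<Sum>i. q ^ i * real (L i)) * weight (A m)" for N m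
    proof -
      have eq: "starts n (loops L {x n} (k n)) = B n" for n by (simp add: B_def A_def)
      show ?thesis
        using starts_correlation[OF summ, where x = x and k = k and N = N and m = m]
        unfolding eq prob_B .
    qed
    show "(\<lambda>n. 2 * g n) \<longlonglongrightarrow> 0" using tendsto_mult_right_zero[OF g0, of 2] by simp
    show "0 \<le> (\<Sum>i. q ^ i * real (L i))" using q_pos by (intro suminf_nonneg summ) auto
  qed (fact prob_B div bad)+
  then show ?thesis
    using AE_proper
  proof eventually_elim
    case (elim \<omega>)
    obtain N0 where N0: "\<And>n. n \<ge> N0 \<Longrightarrow> x n \<noteq> 0 \<and> ln (real n) \<ge> 1"
      using eventually_conj[OF far ln_large[of 1]] by (auto simp: eventually_sequentially)
    show ?case
      unfolding INFM_nat_le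
    proof
      fix m
      obtain n where n: "n \<ge> max m N0" "\<omega> \<in> B n - D n"
        using elim(1) unfolding INFM_nat_le by blast
      then have xn: "x n \<noteq> 0" and lnn: "ln (real n) \<ge> 1" using N0[of n] by auto
      have "ereal (lam M X * (ln (real n) + ln (ln (real n)))) \<le> ereal (real (k n))"
        unfolding k_def using level_bounds(1)[OF q1 lnn] by simp
      also have "\<dots> \<le> local_time X (walk X n \<omega>) \<omega>"
        using n unfolding B_def A_def by (intro starts_visits) auto
      finally have heavy: "ereal (lam M X * (ln (real n) + ln (ln (real n)))) \<le> local_time X (walk X n \<omega>) \<omega>" .
      have "local_time X (walk X n \<omega> + x n) \<omega> = 0"
        using n xn elim(2) unfolding B_def A_def D_def by (intro starts_unhit) auto
      then show "\<exists>n\<ge>m. ereal (lam M X * (ln (real n) + ln (ln (real n)))) \<le> local_time X (walk X n \<omega>) \<omega>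
          \<and> local_time X (walk X n \<omega> + x n) \<omega> = 0"
        using heavy n by auto
    qed
  qed
qed

end

lemma lattice_walk_of_steps:
  fixes X :: "nat \<Rightarrow> 'a \<Rightarrow> int ^ 'd"
  assumes "simple_symmetric_steps M X"
  shows "lattice_walk M X"
proof -
  have M: "prob_space M" and ind: "prob_space.indep_vars M (\<lambda>_. count_space UNIV) X {1..}"
    and st: "\<And>k i. k \<ge> 1 \<Longrightarrow> measure M {\<omega> \<in> space M. X k \<omega> = axis i 1} = 1 / (2 * real CARD('d)) \<and>
        measure M {\<omega> \<in> space M. X k \<omega> = - axis i 1} = 1 / (2 * real CARD('d))"
    using assms unfolding simple_symmetric_steps_def by auto
  show ?thesis
    unfolding lattice_walk_def lattice_walk_axioms_def
  proof (intro conjI allI impI M ind)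
    fix k :: nat and e :: "int ^ 'd"
    assume k: "k \<ge> 1" and e: "e \<in> unit_steps"
    then show "measure M {\<omega> \<in> space M. X k \<omega> = e} = step_prob TYPE('d)"
      using st[OF k] by (auto simp: unit_steps_def step_prob_def)
  qed
qed

lemma lattice_norm_axis: "lattice_norm (axis i z) = \<bar>real_of_int z\<bar>"
proof -
  have "((\<chi> j. real_of_int (axis i z $ j)) :: real ^ 'a) = real_of_int z *\<^sub>R axis i 1"
    by (simp add: vec_eq_iff axis_def)
  then show ?thesis unfolding lattice_norm_def by simp
qed

text \<open>A ball that reaches an unvisited point is not covered.\<close>

lemma covered_radius_le:
  assumes "local_time X (walk X j \<omega> + y) \<omega> = 0"
  shows "covered_radius X j \<omega> \<le> ereal (lattice_norm y)"
  unfolding covered_radius_def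
proof (rule Sup_least)
  fix e assume "e \<in> {ereal \<rho> | \<rho>. \<rho> \<ge> 0 \<and> (\<forall>x\<in>lattice_ball \<rho>. local_time X (walk X j \<omega> + x) \<omega> > 0)}"
  then obtain \<rho> where \<rho>: "e = ereal \<rho>" "\<And>x. x \<in> lattice_ball \<rho> \<Longrightarrow> local_time X (walk X j \<omega> + x) \<omega> > 0"
    by auto
  have "y \<notin> lattice_ball \<rho>" using \<rho>(2)[of y] assms by auto
  then show "e \<le> ereal (lattice_norm y)" using \<rho>(1) by (simp add: lattice_ball_def)
qed

theorem theorem1p3:
  fixes M :: "'a measure"
    and X :: "nat \<Rightarrow> 'a \<Rightarrow> int ^ 'd"
    and x :: "nat \<Rightarrow> int ^ 'd"
    and c :: real
  assumes dim: "CARD('d) \<ge> 3"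
    and walk: "simple_symmetric_steps M X"
    and c: "c > 0"
    and x: "(\<lambda>n. lattice_norm (x n))
              \<sim>[at_top] (\<lambda>n. c * ln (real n) powr (1 / (2 * real CARD('d) - 4)))"
  shows "(\<forall>\<epsilon>>0. AE \<omega> in M. \<exists>\<^sub>\<infinity>n.
            local_time X (walk X n \<omega>) \<omega>
              \<ge> ereal (lam M X * (ln (real n)
                   + ((real CARD('d) - 4) / (real CARD('d) - 2) - \<epsilon>) * ln (ln (real n))))
            \<and> local_time X (walk X n \<omega> + x n) \<omega> = 0)
       \<and> (\<forall>\<delta> r. admissible_rates CARD('d) \<delta> r \<longrightarrow>
            (AE \<omega> in M. \<exists>\<^sub>\<infinity>n.
               n \<in> frequent_times M X \<delta> n \<omega>
               \<and> covered_radius X n \<omega>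
                    \<le> ereal (c * ln (real n) powr (1 / (2 * real CARD('d) - 4)))))"
proof -
  interpret lattice_walk M X by (rule lattice_walk_of_steps[OF walk])
  let ?\<rho> = "\<lambda>n. ln (real n) powr (1 / (2 * real CARD('d) - 4))"
  have lam: "lam M X > 0"
    using q_pos q_less_1[OF dim] by (simp add: lam_q divide_neg_neg)
  have ln_large: "eventually (\<lambda>n. b \<le> ln (real n)) sequentially" for b
    using filterlim_compose[OF ln_at_top filterlim_real_sequentially] by (simp add: filterlim_at_top)
  show ?thesis
  proof (intro conjI allI impI)
    fix \<epsilon> :: real assume \<epsilon>: "\<epsilon> > 0"
    let ?\<beta> = "(real CARD('d) - 4) / (real CARD('d) - 2) - \<epsilon>"
    have \<beta>: "?\<beta> \<le> 1"
    proof -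
      have "(real CARD('d) - 4) / (real CARD('d) - 2) \<le> 1" using dim by simp
      then show ?thesis using \<epsilon> by linarith
    qed
    \<comment> \<open>Asymptotic equivalence gives the lower bound on the distance up to any factor below \<open>1\<close>.\<close>
    have "eventually (\<lambda>n. c * ?\<rho> n * (1 / 2) \<le> lattice_norm (x n)) sequentially"
    proof -
      have "eventually (\<lambda>n. 1 / 2 < (if lattice_norm (x n) = 0 \<and> c * ?\<rho> n = 0 then 1
          else lattice_norm (x n) / (c * ?\<rho> n))) sequentially"
        by (rule order_tendstoD(1)[OF asymp_equivD[OF x]]) simp
      then show ?thesis using ln_large[of 1]
      proof eventually_elim
        case (elim n)
        have "0 < c * ?\<rho> n" using c elim by simp
        then have nz: "\<not> (lattice_norm (x n) = 0 \<and> c * ?\<rho> n = 0)" by linarith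
        have "1 / 2 < lattice_norm (x n) / (c * ?\<rho> n)"
          using elim(1) unfolding if_not_P[OF nz] .
        with \<open>0 < c * ?\<rho> n\<close> show ?case by (simp only: less_divide_eq if_True mult.commute less_imp_le)
      qed
    qed
    then have "eventually (\<lambda>n. (c / 2) * ?\<rho> n \<le> lattice_norm (x n)) sequentially" by simp
    from heavy_point_near_unvisited_point[OF dim _ this] c
    have "AE \<omega> in M. \<exists>\<^sub>\<infinity>n. ereal (lam M X * (ln (real n) + ln (ln (real n)))) \<le> local_time X (walk X n \<omega>) \<omega>
      \<and> local_time X (walk X n \<omega> + x n) \<omega> = 0" by simp
    then show "AE \<omega> in M. \<exists>\<^sub>\<infinity>n. local_time X (walk X n \<omega>) \<omega>
              \<ge> ereal (lam M X * (ln (real n) + ?\<beta> * ln (ln (real n))))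
            \<and> local_time X (walk X n \<omega> + x n) \<omega> = 0"
    proof eventually_elim
      case (elim \<omega>)
      have "eventually (\<lambda>n. lam M X * (ln (real n) + ?\<beta> * ln (ln (real n))) \<le> lam M X * (ln (real n) + ln (ln (real n)))) sequentially"
        using ln_large[of 1]
      proof eventually_elim
        case (elim n)
        have "?\<beta> * ln (ln (real n)) \<le> 1 * ln (ln (real n))"
          using elim by (intro mult_right_mono \<beta>) auto
        then show ?case using lam by (intro mult_left_mono) auto
      qed
      then have "eventually (\<lambda>n. ereal (lam M X * (ln (real n) + ln (ln (real n)))) \<le> local_time X (walk X n \<omega>) \<omega>
          \<and> local_time X (walk X n \<omega> + x n) \<omega> = 0 \<longrightarrow>
          local_time X (walk X n \<omega>) \<omega> \<ge> ereal (lam M X * (ln (real n) + ?\<beta> * ln (ln (real n))))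
            \<and> local_time X (walk X n \<omega> + x n) \<omega> = 0) sequentially"
        by eventually_elim (auto intro: order_trans[rotated])
      with elim show ?case
        unfolding cofinite_eq_sequentially by (rule frequently_mp[rotated])
    qed
  next
    fix \<delta> r :: "nat \<Rightarrow> real" assume rates: "admissible_rates CARD('d) \<delta> r"
    then have \<delta>: "\<delta> n > 0" if "n \<ge> 1" for n using that by (simp add: admissible_rates_def)
    obtain i :: 'd where True by simp
    \<comment> \<open>Rounding down keeps the uncovered point within the exact radius and beyond half of it.\<close>
    define y :: "nat \<Rightarrow> int ^ 'd" where "y = (\<lambda>n. axis i \<lfloor>c * ?\<rho> n\<rfloor>)"
    have y_le: "lattice_norm (y n) \<le> c * ?\<rho> n" for n
    proof -
      have "0 \<le> c * ?\<rho> n" using c by simp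
      then have "0 \<le> \<lfloor>c * ?\<rho> n\<rfloor>" by simp
      then show ?thesis unfolding y_def lattice_norm_axis by simp
    qed
    have large: "filterlim (\<lambda>n. c * ?\<rho> n) at_top sequentially"
    proof (rule filterlim_tendsto_pos_mult_at_top[OF tendsto_const c])
      have "1 / (2 * real CARD('d) - 4) > 0" using dim by simp
      from real_powr_at_top[OF this] show "filterlim ?\<rho> at_top sequentially"
        by (rule filterlim_compose) (rule filterlim_compose[OF ln_at_top filterlim_real_sequentially])
    qed
    have "eventually (\<lambda>n. (c / 2) * ?\<rho> n \<le> lattice_norm (y n)) sequentially"
    proof -
      have "eventually (\<lambda>n. 2 \<le> c * ?\<rho> n) sequentially"
        using large by (simp add: filterlim_at_top)
      then show ?thesis
      proof eventually_elim
        case (elim n)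
        then show ?case unfolding y_def lattice_norm_axis by linarith
      qed
    qed
    from heavy_point_near_unvisited_point[OF dim _ this] c
    have "AE \<omega> in M. \<exists>\<^sub>\<infinity>n. ereal (lam M X * (ln (real n) + ln (ln (real n)))) \<le> local_time X (walk X n \<omega>) \<omega>
      \<and> local_time X (walk X n \<omega> + y n) \<omega> = 0" by simp
    then show "AE \<omega> in M. \<exists>\<^sub>\<infinity>n. n \<in> frequent_times M X \<delta> n \<omega> \<and> covered_radius X n \<omega> \<le> ereal (c * ?\<rho> n)"
    proof eventually_elim
      case (elim \<omega>)
      have "eventually (\<lambda>n. (1 - \<delta> n) * lam M X * ln (real n) \<le> lam M X * (ln (real n) + ln (ln (real n)))) sequentially"
        using ln_large[of 1] eventually_ge_at_top[of 1]
      proof eventually_elim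
        case (elim n)
        have "(1 - \<delta> n) * (lam M X * ln (real n)) \<le> 1 * (lam M X * ln (real n))"
          using \<delta>[OF elim(2)] lam elim by (intro mult_right_mono) auto
        moreover have "0 \<le> lam M X * ln (ln (real n))" using lam elim by simp
        ultimately show ?case by (simp add: algebra_simps)
      qed
      then have "eventually (\<lambda>n. ereal (lam M X * (ln (real n) + ln (ln (real n)))) \<le> local_time X (walk X n \<omega>) \<omega>
          \<and> local_time X (walk X n \<omega> + y n) \<omega> = 0 \<longrightarrow>
          n \<in> frequent_times M X \<delta> n \<omega> \<and> covered_radius X n \<omega> \<le> ereal (c * ?\<rho> n)) sequentially"
      proof eventually_elim
        case (elim n)
        show ?case
        proof (intro impI conjI)
          assume hyp: "ereal (lam M X * (ln (real n) + ln (ln (real n)))) \<le> local_time X (walk X n \<omega>) \<omega>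
            \<and> local_time X (walk X n \<omega> + y n) \<omega> = 0"
          have "ereal ((1 - \<delta> n) * lam M X * ln (real n)) \<le> ereal (lam M X * (ln (real n) + ln (ln (real n))))"
            using elim by simp
          also have "\<dots> \<le> local_time X (walk X n \<omega>) \<omega>" using hyp by (rule conjunct1)
          finally show "n \<in> frequent_times M X \<delta> n \<omega>"
            unfolding frequent_times_def by simp
          have "covered_radius X n \<omega> \<le> ereal (lattice_norm (y n))"
            using hyp by (intro covered_radius_le) simp
          also have "\<dots> \<le> ereal (c * ?\<rho> n)" using y_le by simp
          finally show "covered_radius X n \<omega> \<le> ereal (c * ?\<rho> n)" .
        qed
      qed
      with elim show ?case
        unfolding cofinite_eq_sequentially by (rule frequently_mp[rotated])
    qed
  qed
qed

end
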